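(* Let $X$ be a compact metric space, $\varepsilon>0$, and $c\in C(X\times X;[0,\infty))$ symmetric such that $k_c=\exp(-c/\varepsilon)$ is a positive definite universal kernel. Define $A:\mathcal{P}(X)\to\mathcal{M}(X)$ and $B:\mathcal{P}(X)\to\mathcal{H}_c$ by $$A(\mu)=\exp(f_{\mu,\mu}/\varepsilon)\,\mu,\qquad B(\mu)=H_c[A(\mu)]=\exp(-f_{\mu,\mu}/\varepsilon).$$ The maps $A$ and $B$ are homeomorphisms onto their images. Explicitly: 1. $A$ is a homeomorphism, for the weak-$*$ topologies, onto $\mathcal{A}=\{\alpha\in\mathcal{M}_+(X):\|H_c[\alpha]\|_{\mathcal{H}_c}=1\}$, with inverse $A^{-1}(\alpha)=(P_1)_\#(k_c\cdot\alpha\otimes\alpha)$. In particular $\mathcal{A}$ is weak-$*$ compact. 2. $B$ is a homeomorphism from $\mathcal{P}(X)$ with the weak-$*$ topology onto $\mathcal{B}=\{\beta\in H_c[\mathcal{M}_+(X)]:\|\beta\|_{\mathcal{H}_c}=1\}$ with the weak topology of $\mathcal{H}_c$. Weak convergence and norm convergence agree on $\mathcal{B}$, and the set $\mathcal{B}$ is weakly and norm compact in $\mathcal{H}_c$.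
   Context: $\mathcal{M}(X)$: signed Radon measures on $X$ (dual of $C(X)$); $\mathcal{M}_+(X)$: non-negative ones; $\mathcal{P}(X)$: probability measures. A kernel is universal if its reproducing kernel Hilbert space (RKHS) is dense in $C(X)$ for the supremum norm. $\mathcal{H}_c$ is the RKHS of $k_c$, and $H_c[\nu](y)=\int_X k_c(x,y)\,d\nu(x)$ is the kernel mean embedding $\mathcal{M}(X)\to\mathcal{H}_c$. $P_1(x,y)=x$, and $k_c\cdot\alpha\otimes\alpha$ is the measure on $X\times X$ with density $k_c$ with respect to $\alpha\otimes\alpha$. For $\mu\in\mathcal{P}(X)$, $f_{\mu,\mu}\in C(X)$ is the (self-transport Schrödinger potential) unique function such that $\int_X\exp\left(\frac1\varepsilon(f_{\mu,\mu}(x)+f_{\mu,\mu}(y)-c(x,y))\right)d\mu(x)=1$ for all $y\in X$. *)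

theory Defs
  imports "HOL-Probability.Probability"
begin

text \<open>
  The compact metric space is the whole type, so every finite Borel measure on it is Radon and
  the set below is the cone of non-negative Radon measures.
\<close>

definition nonneg_measures :: "'a::metric_space measure set" where
  "nonneg_measures = {\<nu>. sets \<nu> = sets borel \<and> finite_measure \<nu>}"

definition prob_measures :: "'a::metric_space measure set" where
  "prob_measures = {\<mu>. sets \<mu> = sets borel \<and> prob_space \<mu>}"

text \<open>
  The coarsest topology on the non-negative measures for which integration against every
  element of $C(X)$ is continuous, that is, the trace on the non-negative cone of the weak-*
  topology of the signed measures.  Since $X$ is compact, $C(X)$ with the supremum norm is the
  type of bounded continuous functions.
\<close>

definition weak_star :: "'a::metric_space measure topology" where
  "weak_star =
     pullback_topology nonneg_measures (\<lambda>\<nu> \<phi>. \<integral>x. apply_bcontfun \<phi> x \<partial>\<nu>)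
       (product_topology (\<lambda>_ :: 'a \<Rightarrow>\<^sub>C real. euclideanreal) UNIV)"

text \<open>
  A space of real functions is given by its carrier \<open>H\<close> and an inner product \<open>ip\<close>, whose
  values are only meaningful on \<open>H\<close>.
\<close>

definition ip_norm :: "(('a \<Rightarrow> real) \<Rightarrow> ('a \<Rightarrow> real) \<Rightarrow> real) \<Rightarrow> ('a \<Rightarrow> real) \<Rightarrow> real" where
  "ip_norm ip f = sqrt (ip f f)"

text \<open>
  The value 0 outside \<open>H\<close> is irrelevant; it is there because the locale \<^locale>\<open>Metric_space\<close>
  asks for a distance that is symmetric and non-negative on the whole type.
\<close>

definition ip_dist ::
  "('a \<Rightarrow> real) set \<Rightarrow> (('a \<Rightarrow> real) \<Rightarrow> ('a \<Rightarrow> real) \<Rightarrow> real) \<Rightarrow> ('a \<Rightarrow> real) \<Rightarrow> ('a \<Rightarrow> real) \<Rightarrow> real" where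
  "ip_dist H ip f g = (if f \<in> H \<and> g \<in> H then ip_norm ip (\<lambda>x. f x - g x) else 0)"

definition hilbert_function_space ::
  "('a \<Rightarrow> real) set \<Rightarrow> (('a \<Rightarrow> real) \<Rightarrow> ('a \<Rightarrow> real) \<Rightarrow> real) \<Rightarrow> bool" where
  "hilbert_function_space H ip \<longleftrightarrow>
     (\<lambda>x. 0) \<in> H \<and>
     (\<forall>f\<in>H. \<forall>g\<in>H. \<forall>a b. (\<lambda>x. a * f x + b * g x) \<in> H) \<and>
     (\<forall>f\<in>H. \<forall>g\<in>H. ip f g = ip g f) \<and>
     (\<forall>f\<in>H. \<forall>g\<in>H. \<forall>h\<in>H. \<forall>a b. ip (\<lambda>x. a * f x + b * g x) h = a * ip f h + b * ip g h) \<and>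
     (\<forall>f\<in>H. 0 \<le> ip f f) \<and>
     (\<forall>f\<in>H. ip f f = 0 \<longrightarrow> f = (\<lambda>x. 0)) \<and>
     Metric_space.mcomplete H (ip_dist H ip)"

text \<open>By the Moore-Aronszajn theorem, every positive definite kernel \<open>k\<close> has exactly one RKHS.\<close>

definition is_rkhs ::
  "('a \<Rightarrow> 'a \<Rightarrow> real) \<Rightarrow> ('a \<Rightarrow> real) set \<Rightarrow> (('a \<Rightarrow> real) \<Rightarrow> ('a \<Rightarrow> real) \<Rightarrow> real) \<Rightarrow> bool" where
  "is_rkhs k H ip \<longleftrightarrow>
     hilbert_function_space H ip \<and>
     (\<forall>x. (\<lambda>y. k x y) \<in> H) \<and>
     (\<forall>f\<in>H. \<forall>x. ip f (\<lambda>y. k x y) = f x)"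

definition rkhs_norm_topology ::
  "('a \<Rightarrow> real) set \<Rightarrow> (('a \<Rightarrow> real) \<Rightarrow> ('a \<Rightarrow> real) \<Rightarrow> real) \<Rightarrow> ('a \<Rightarrow> real) topology" where
  "rkhs_norm_topology H ip = Metric_space.mtopology H (ip_dist H ip)"

definition rkhs_dual ::
  "('a \<Rightarrow> real) set \<Rightarrow> (('a \<Rightarrow> real) \<Rightarrow> ('a \<Rightarrow> real) \<Rightarrow> real) \<Rightarrow> (('a \<Rightarrow> real) \<Rightarrow> real) set" where
  "rkhs_dual H ip =
     {l. (\<forall>f\<in>H. \<forall>g\<in>H. \<forall>a b. l (\<lambda>x. a * f x + b * g x) = a * l f + b * l g) \<and>
         continuous_map (rkhs_norm_topology H ip) euclideanreal l}"

definition rkhs_weak_topology ::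
  "('a \<Rightarrow> real) set \<Rightarrow> (('a \<Rightarrow> real) \<Rightarrow> ('a \<Rightarrow> real) \<Rightarrow> real) \<Rightarrow> ('a \<Rightarrow> real) topology" where
  "rkhs_weak_topology H ip =
     pullback_topology H (\<lambda>f. \<lambda>l\<in>rkhs_dual H ip. l f)
       (product_topology (\<lambda>_. euclideanreal) (rkhs_dual H ip))"

definition mean_embedding :: "('a \<Rightarrow> 'a \<Rightarrow> real) \<Rightarrow> 'a measure \<Rightarrow> 'a \<Rightarrow> real" where
  "mean_embedding k \<nu> = (\<lambda>y. \<integral>x. k x y \<partial>\<nu>)"

text \<open>Positive definite in the usual, non-strict sense of the RKHS literature.\<close>

definition positive_definite_kernel :: "('a \<Rightarrow> 'a \<Rightarrow> real) \<Rightarrow> bool" where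
  "positive_definite_kernel k \<longleftrightarrow>
     (\<forall>x y. k x y = k y x) \<and>
     (\<forall>S a. finite S \<longrightarrow> 0 \<le> (\<Sum>x\<in>S. \<Sum>y\<in>S. a x * a y * k x y))"

text \<open>For a subspace \<open>H\<close> of functions: \<open>H\<close> is contained and dense in $C(X)$.\<close>

definition dense_in_continuous :: "('a::metric_space \<Rightarrow> real) set \<Rightarrow> bool" where
  "dense_in_continuous H \<longleftrightarrow>
     (\<forall>f\<in>H. continuous_on UNIV f) \<and>
     closure {\<phi> :: 'a \<Rightarrow>\<^sub>C real. apply_bcontfun \<phi> \<in> H} = UNIV"

definition gibbs_kernel :: "real \<Rightarrow> ('a \<Rightarrow> 'a \<Rightarrow> real) \<Rightarrow> 'a \<Rightarrow> 'a \<Rightarrow> real" where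
  "gibbs_kernel \<epsilon> c x y = exp (- c x y / \<epsilon>)"

definition self_potential ::
  "real \<Rightarrow> ('a::metric_space \<Rightarrow> 'a \<Rightarrow> real) \<Rightarrow> 'a measure \<Rightarrow> 'a \<Rightarrow> real" where
  "self_potential \<epsilon> c \<mu> =
     (THE f. continuous_on UNIV f \<and>
        (\<forall>y. (\<integral>x. exp (1 / \<epsilon> * (f x + f y - c x y)) \<partial>\<mu>) = 1))"

definition map_A ::
  "real \<Rightarrow> ('a::metric_space \<Rightarrow> 'a \<Rightarrow> real) \<Rightarrow> 'a measure \<Rightarrow> 'a measure" where
  "map_A \<epsilon> c \<mu> = density \<mu> (\<lambda>x. ennreal (exp (self_potential \<epsilon> c \<mu> x / \<epsilon>)))"

definition map_B ::
  "real \<Rightarrow> ('a::metric_space \<Rightarrow> 'a \<Rightarrow> real) \<Rightarrow> 'a measure \<Rightarrow> 'a \<Rightarrow> real" where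
  "map_B \<epsilon> c \<mu> = mean_embedding (gibbs_kernel \<epsilon> c) (map_A \<epsilon> c \<mu>)"

definition kernel_marginal :: "('a::metric_space \<Rightarrow> 'a \<Rightarrow> real) \<Rightarrow> 'a measure \<Rightarrow> 'a measure" where
  "kernel_marginal k \<alpha> =
     distr (density (\<alpha> \<Otimes>\<^sub>M \<alpha>) (\<lambda>(x, y). ennreal (k x y))) borel fst"

definition image_A ::
  "('a::metric_space \<Rightarrow> 'a \<Rightarrow> real) \<Rightarrow> (('a \<Rightarrow> real) \<Rightarrow> ('a \<Rightarrow> real) \<Rightarrow> real) \<Rightarrow> 'a measure set" where
  "image_A k ip = {\<alpha> \<in> nonneg_measures. ip_norm ip (mean_embedding k \<alpha>) = 1}"

definition image_B ::
  "('a::metric_space \<Rightarrow> 'a \<Rightarrow> real) \<Rightarrow> (('a \<Rightarrow> real) \<Rightarrow> ('a \<Rightarrow> real) \<Rightarrow> real) \<Rightarrow> ('a \<Rightarrow> real) set" where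
  "image_B k ip = {\<beta> \<in> mean_embedding k ` nonneg_measures. ip_norm ip \<beta> = 1}"

end

theory Submission
  imports Defs
begin

text \<open>
  Write \<open>K \<alpha>\<close> for the mean embedding of \<open>\<alpha>\<close>. By the Riesz representation theorem \<open>K \<alpha>\<close> lies in \<open>H\<close> and
  \<open>\<langle>h, K \<alpha>\<rangle> = \<integral> h d\<alpha>\<close>, and by density of \<open>H\<close> the map \<open>K\<close> is injective. The measures
  in \<open>\<A>\<close> have masses in a compact subinterval of the positive reals, so weak-* sequential compactness of the
  probability measures and uniform convergence of \<open>K \<alpha>\<^sub>n\<close> along weakly convergent \<open>\<alpha>\<^sub>n\<close> make \<open>\<B>\<close> norm compact.
  From the compact space \<open>\<B>\<close> the maps \<open>K\<^sup>-\<^sup>1\<close>, \<open>\<beta> \<mapsto> \<beta> K\<^sup>-\<^sup>1 \<beta>\<close> and the identity into the weak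
  topology are continuous bijections onto Hausdorff spaces, hence homeomorphisms, and all claims follow.

  The bijectivity of \<open>\<alpha> \<mapsto> (K \<alpha>) \<alpha>\<close> is existence and uniqueness of \<open>g = exp (- f / \<epsilon>)\<close> with \<open>K (\<mu> / g) = g\<close>.
  For existence, let \<open>\<beta>\<close> maximise \<open>\<integral> ln \<beta> d\<mu>\<close> over \<open>\<B>\<close>. Varying \<open>\<beta>\<close> in the directions \<open>k z\<close> gives
  \<open>K (\<mu> / \<beta>) \<le> \<beta>\<close>; then \<open>\<parallel>K (\<mu> / \<beta>)\<parallel>\<^sup>2 \<le> 1\<close>, while \<open>\<langle>K (\<mu> / \<beta>), \<beta>\<rangle> = 1\<close>, hence \<open>\<parallel>\<beta> - K (\<mu> / \<beta>)\<parallel>\<^sup>2 \<le> 0\<close>.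
\<close>

section \<open>Weak-* sequential compactness of the probability measures\<close>

text \<open>Continuity is only ever tested along norm convergent sequences. No map is shown
  continuous directly out of a weak-* space, and metrizability of the weak-* topology is never
  established; this is why both homeomorphisms are factored through \<B>. Continuous dependence of
  the potential on \<mu> needs no estimate of its own either: it comes out of compactness of \<B>
  and uniqueness of the scaling.

  The functional \<integral> ln \<beta> d\<mu> is chosen for its first variation. Along \<beta> + t
  k z, rescaled to norm 1, its derivative at t = 0 is K (\<mu> / \<beta>) z - \<beta> z: the first
  term comes from the logarithm, the second from the rescaling, and no multiplier appears because
  \<mu> has mass 1. The elements of \<B> come from non-negative measures, so mass can be added at z
  but in general not removed. Hence t \<ge> 0, and maximality yields an inequality only; the inner
  products of \<beta> and K (\<mu> / \<beta>) turn it into an equality.\<close>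

lemma ternary_code_separates:
  fixes a b :: "nat \<Rightarrow> real"
  assumes a: "\<And>i. a i \<in> {0, 1}" and b: "\<And>i. b i \<in> {0, 1}"
    and close: "\<bar>(\<Sum>i. a i * (2 / 3 ^ Suc i)) - (\<Sum>i. b i * (2 / 3 ^ Suc i))\<bar> < 1 / 3 ^ Suc N"
    and "j \<le> N"
  shows "a j = b j"
proof (rule ccontr)
  assume "a j \<noteq> b j"
  \<comment> \<open>At the first index of disagreement the terms differ by 2 / 3^(l+1), while all
    later terms together contribute at most 1 / 3^(l+1). The remaining gap of 1 / 3^(l+1) is the
    reason for base 3: binary digits would let the tail cancel the leading difference.\<close>
  define l where "l = (LEAST j. a j \<noteq> b j)"
  have l: "a l \<noteq> b l" unfolding l_def by (rule LeastI[of _ j]) fact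
  have "l \<le> j" unfolding l_def by (rule Least_le) fact
  have eq: "a i = b i" if "i < l" for i
    using that not_less_Least unfolding l_def by blast
  have geo: "(\<lambda>i. 2 / 3 ^ Suc i :: real) sums 1"
    using sums_mult[OF geometric_sums[of "1/3::real"], of "2/3"] by (simp add: power_divide)
  define d where "d i = (a i - b i) * (2 / 3 ^ Suc i)" for i
  have ab1: "\<bar>a i\<bar> \<le> 1" "\<bar>b i\<bar> \<le> 1" "\<bar>a i - b i\<bar> \<le> 1" for i using a[of i] b[of i] by auto
  have sa: "summable (\<lambda>i. a i * (2 / 3 ^ Suc i))"
    by (rule summable_comparison_test'[OF sums_summable[OF geo]])
       (use ab1 in \<open>simp add: abs_mult divide_right_mono\<close>)
  have sb: "summable (\<lambda>i. b i * (2 / 3 ^ Suc i))"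
    by (rule summable_comparison_test'[OF sums_summable[OF geo]])
       (use ab1 in \<open>simp add: abs_mult divide_right_mono\<close>)
  have sd: "summable d" and dsum: "suminf d = (\<Sum>i. a i * (2 / 3 ^ Suc i)) - (\<Sum>i. b i * (2 / 3 ^ Suc i))"
    using summable_diff[OF sa sb] suminf_diff[OF sa sb] unfolding d_def left_diff_distrib by simp_all
  have "suminf d = (\<Sum>i. d (i + Suc l)) + (\<Sum>i<Suc l. d i)"
    by (rule suminf_split_initial_segment[OF sd])
  also have "(\<Sum>i<Suc l. d i) = d l" by (simp add: d_def eq)
  finally have split: "suminf d = (\<Sum>i. d (i + Suc l)) + d l" .
  have tail_sums: "(\<lambda>i. 2 / 3 ^ Suc (i + Suc l) :: real) sums (1 / 3 ^ Suc l)"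
    using sums_mult[OF geo, of "1 / 3 ^ Suc l"] by (simp add: power_add mult_ac)
  have d_le: "\<bar>d i\<bar> \<le> 2 / 3 ^ Suc i" for i
    unfolding d_def abs_mult using mult_right_mono[OF ab1(3)[of i], of "2 / 3 ^ Suc i"] by simp
  have sdt: "summable (\<lambda>i. \<bar>d (i + Suc l)\<bar>)"
    by (rule summable_comparison_test'[OF sums_summable[OF tail_sums]]) (use d_le in \<open>simp only: real_norm_def abs_abs\<close>)
  have "\<bar>\<Sum>i. d (i + Suc l)\<bar> \<le> (\<Sum>i. \<bar>d (i + Suc l)\<bar>)" by (rule summable_rabs[OF sdt])
  also have "\<dots> \<le> (\<Sum>i. 2 / 3 ^ Suc (i + Suc l))"
    by (rule suminf_le[OF d_le sdt sums_summable[OF tail_sums]])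
  also have "\<dots> = 1 / 3 ^ Suc l" using tail_sums by (simp add: sums_iff)
  finally have tail: "\<bar>\<Sum>i. d (i + Suc l)\<bar> \<le> 1 / 3 ^ Suc l" .
  have "\<bar>a l - b l\<bar> = 1" using l a[of l] b[of l] by auto
  then have "\<bar>d l\<bar> = 2 * (1 / 3 ^ Suc l)" unfolding d_def by (simp add: abs_mult)
  with tail split have "1 / 3 ^ Suc l \<le> \<bar>suminf d\<bar>" by linarith
  moreover have "(1::real) / 3 ^ Suc N \<le> 1 / 3 ^ Suc l"
    using \<open>l \<le> j\<close> \<open>j \<le> N\<close> by (intro divide_left_mono power_increasing) auto
  ultimately show False using close dsum by linarith
qed

text \<open>The family consists of the balls of radius 1 / Suc n around finite nets, for all n. The
  index bound \<open>N\<close> is what matters later: a point that belongs to the same sets with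
  index at most \<open>N\<close> as x is within \<eta> of x.\<close>

lemma compact_countable_ball_family:
  assumes "compact (UNIV :: 'a::metric_space set)"
  obtains U :: "nat \<Rightarrow> 'a::metric_space set" where "\<And>i. open (U i)"
    "\<And>\<eta>. \<eta> > 0 \<Longrightarrow> \<exists>N. \<forall>x. \<exists>j\<le>N. x \<in> U j \<and> (\<forall>y\<in>U j. dist x y < \<eta>)"
proof -
  have "\<exists>S. finite S \<and> (UNIV::'a set) \<subseteq> (\<Union>x\<in>S. ball x (1 / Suc n))" for n :: nat
  proof -
    have "(0::real) < 1 / Suc n" by simp
    then show ?thesis using assms unfolding compact_eq_totally_bounded by blast
  qed
  then obtain S where S: "\<And>n. finite (S n)" "\<And>n. (UNIV::'a set) \<subseteq> (\<Union>x\<in>S n. ball x (1 / Suc n))" by metis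
  define B where "B = (\<Union>n. (\<lambda>x. ball x (1 / Suc n)) ` S n)"
  have cB: "countable B" unfolding B_def using S(1) by (auto intro: countable_finite)
  have "B \<noteq> {}" unfolding B_def using S(2) by fastforce
  then have rB: "range (from_nat_into B) = B" by (rule range_from_nat_into[OF _ cB])
  show thesis
  proof
    show "open (from_nat_into B i)" for i
      using from_nat_into[OF \<open>B \<noteq> {}\<close>, of i] by (auto simp: B_def)
    fix \<eta> :: real assume "\<eta> > 0"
    then obtain n where n: "1 / Suc n < \<eta> / 2" using nat_approx_posE[of "\<eta>/2"] by auto
    define J where "J x = to_nat_on B (ball x (1 / Suc n))" for x
    have J: "from_nat_into B (J x) = ball x (1 / Suc n)" if "x \<in> S n" for x
      unfolding J_def by (rule from_nat_into_to_nat_on[OF cB]) (use that in \<open>auto simp: B_def\<close>)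
    show "\<exists>N. \<forall>x. \<exists>j\<le>N. x \<in> from_nat_into B j \<and> (\<forall>y\<in>from_nat_into B j. dist x y < \<eta>)"
    proof (rule exI[of _ "Max (J ` S n)"], rule allI)
      fix x :: 'a
      obtain z where z: "z \<in> S n" "x \<in> ball z (1 / Suc n)" using S(2)[of n] by blast
      have "J z \<le> Max (J ` S n)" using z S(1) by simp
      moreover have "dist x y < \<eta>" if "y \<in> ball z (1 / Suc n)" for y
        using dist_triangle2[of x y z] that z(2) n by (simp add: dist_commute)
      ultimately show "\<exists>j\<le>Max (J ` S n). x \<in> from_nat_into B j \<and> (\<forall>y\<in>from_nat_into B j. dist x y < \<eta>)"
        using z J[OF z(1)] by auto
    qed
  qed
qed

text \<open>The ternary digits of \<open>e x\<close> record which sets \<open>U i\<close> contain x.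
  Codes closer than 1 / 3^(N+1) agree in the digits up to \<open>N\<close>, so the inverse of
  \<open>e\<close> is uniformly continuous although \<open>e\<close> may jump at the boundaries of
  the balls.\<close>

lemma borel_code:
  assumes "compact (UNIV :: 'a::metric_space set)"
  obtains e :: "'a::metric_space \<Rightarrow> real" where "e \<in> borel_measurable borel" "\<And>x. 0 \<le> e x \<and> e x \<le> 1"
    "\<And>\<eta>. \<eta> > 0 \<Longrightarrow> \<exists>\<delta>>0. \<forall>x y. \<bar>e x - e y\<bar> < \<delta> \<longrightarrow> dist x y < \<eta>"
proof -
  obtain U :: "nat \<Rightarrow> 'a set" where U: "\<And>i. open (U i)"
    "\<And>\<eta>. \<eta> > 0 \<Longrightarrow> \<exists>N. \<forall>x. \<exists>j\<le>N. x \<in> U j \<and> (\<forall>y\<in>U j. dist x y < \<eta>)"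
    using compact_countable_ball_family[OF assms] by metis
  define e where "e x = (\<Sum>i. indicat_real (U i) x * (2 / 3 ^ Suc i))" for x
  have geo: "(\<lambda>i. 2 / 3 ^ Suc i :: real) sums 1"
    using sums_mult[OF geometric_sums[of "1/3::real"], of "2/3"] by (simp add: power_divide)
  have le: "indicat_real (U i) x * (2 / 3 ^ Suc i) \<le> 2 / 3 ^ Suc i" for i x
    by (auto simp: indicator_def)
  have sm: "summable (\<lambda>i. indicat_real (U i) x * (2 / 3 ^ Suc i))" for x
    by (rule summable_comparison_test'[OF sums_summable[OF geo]]) (auto simp: indicator_def)
  show thesis
  proof
    have [measurable]: "U i \<in> sets borel" for i using U(1) by simp
    show "e \<in> borel_measurable borel" unfolding e_def by measurable
    show "0 \<le> e x \<and> e x \<le> 1" for x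
    proof
      show "0 \<le> e x" unfolding e_def by (rule suminf_nonneg[OF sm]) simp
      show "e x \<le> 1"
        using suminf_le[OF le sm sums_summable[OF geo], of x] geo by (simp add: e_def sums_iff)
    qed
    fix \<eta> :: real assume "\<eta> > 0"
    then obtain N where N: "\<And>x. \<exists>j\<le>N. x \<in> U j \<and> (\<forall>y\<in>U j. dist x y < \<eta>)" using U(2) by metis
    show "\<exists>\<delta>>0. \<forall>x y. \<bar>e x - e y\<bar> < \<delta> \<longrightarrow> dist x y < \<eta>"
    proof (intro exI[of _ "1 / 3 ^ Suc N"] conjI allI impI)
      fix x y assume close: "\<bar>e x - e y\<bar> < 1 / 3 ^ Suc N"
      obtain j where j: "j \<le> N" "x \<in> U j" "\<forall>y\<in>U j. dist x y < \<eta>" using N by blast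
      have "indicat_real (U j) x = indicat_real (U j) y"
        by (rule ternary_code_separates[OF _ _ close[unfolded e_def] j(1)]) (auto simp: indicator_def)
      then have "y \<in> U j" using j(2) by (auto simp: indicator_def split: if_splits)
      then show "dist x y < \<eta>" using j(3) by blast
    qed simp
  qed
qed

text \<open>
  Weak limits on \<open>X\<close> are pulled back from Helly's theorem on the real line: points are coded into the
  Cantor set by the sets of small balls that contain them, and the decoding map extends continuously
  to the closure of the set of codes, although the code itself is only Borel measurable.
\<close>

lemma borel_code_with_continuous_decoding:
  assumes "compact (UNIV :: 'a::metric_space set)"
  obtains e :: "'a::metric_space \<Rightarrow> real" and p :: "real \<Rightarrow> 'a::metric_space" and C where
    "e \<in> borel_measurable borel" "\<And>x. 0 \<le> e x \<and> e x \<le> 1"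
    "closed C" "\<And>x. e x \<in> C" "continuous_on C p" "\<And>x. p (e x) = x" "p \<in> borel \<rightarrow>\<^sub>M borel"
proof -
  obtain e :: "'a \<Rightarrow> real" where e: "e \<in> borel_measurable borel" "\<And>x. 0 \<le> e x \<and> e x \<le> 1"
    "\<And>\<eta>. \<eta> > 0 \<Longrightarrow> \<exists>\<delta>>0. \<forall>x y. \<bar>e x - e y\<bar> < \<delta> \<longrightarrow> dist x y < \<eta>"
    using borel_code[OF assms] by metis
  define C where "C = closure (range e)"
  \<comment> \<open>The decoded value at a limit t of codes: compactness gives a limit point q of
    points whose codes tend to t, and the uniform modulus of \<open>e\<close> forces every point
    with a code near t to be near q.\<close>
  have "\<exists>q. \<forall>\<eta>>0. \<exists>\<delta>>0. \<forall>x. \<bar>e x - t\<bar> < \<delta> \<longrightarrow> dist x q \<le> \<eta>" if t: "t \<in> C" for t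
  proof -
    obtain s where s: "\<And>n. s n \<in> range e" "s \<longlonglongrightarrow> t" using t unfolding C_def closure_sequential by blast
    then have "\<exists>x. s n = e x" for n by blast
    then obtain z where z: "\<And>n. s n = e (z n)" by metis
    obtain q r where r: "strict_mono (r :: nat \<Rightarrow> nat)" and q: "(z \<circ> r) \<longlonglongrightarrow> q"
      using assms unfolding compact_eq_seq_compact_metric seq_compact_def by blast
    have er: "(\<lambda>n. e (z (r n))) \<longlonglongrightarrow> t"
      using LIMSEQ_subseq_LIMSEQ[OF s(2) r] by (simp add: z comp_def)
    show ?thesis
    proof (rule exI[of _ q], intro allI impI)
      fix \<eta> :: real assume "\<eta> > 0"
      obtain \<delta> where d: "\<delta> > 0" "\<And>x y. \<bar>e x - e y\<bar> < \<delta> \<Longrightarrow> dist x y < \<eta>" using e(3)[OF \<open>\<eta> > 0\<close>] by blast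
      have "dist x q \<le> \<eta>" if x: "\<bar>e x - t\<bar> < \<delta>/2" for x
      proof (rule tendsto_upperbound)
        show "(\<lambda>n. dist x ((z \<circ> r) n)) \<longlonglongrightarrow> dist x q" by (intro tendsto_intros q)
        have "\<forall>\<^sub>F n in sequentially. dist (e (z (r n))) t < \<delta>/2"
          using er d(1) by (intro tendstoD) auto
        then show "\<forall>\<^sub>F n in sequentially. dist x ((z \<circ> r) n) \<le> \<eta>"
        proof eventually_elim
          case (elim n)
          then have "\<bar>e x - e (z (r n))\<bar> < \<delta>" using x unfolding dist_real_def by linarith
          then show ?case using d(2) by (simp add: less_imp_le)
        qed
      qed simp
      then show "\<exists>\<delta>>0. \<forall>x. \<bar>e x - t\<bar> < \<delta> \<longrightarrow> dist x q \<le> \<eta>" using d(1) by (intro exI[of _ "\<delta>/2"]) auto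
    qed
  qed
  then have "\<forall>t\<in>C. \<exists>q. \<forall>\<eta>>0. \<exists>\<delta>>0. \<forall>x. \<bar>e x - t\<bar> < \<delta> \<longrightarrow> dist x q \<le> \<eta>" by blast
  from bchoice[OF this] obtain p0 where
    p0: "\<And>t. t \<in> C \<Longrightarrow> \<forall>\<eta>>0. \<exists>\<delta>>0. \<forall>x. \<bar>e x - t\<bar> < \<delta> \<longrightarrow> dist x (p0 t) \<le> \<eta>" by blast
  \<comment> \<open>Being constant off the closed set \<open>C\<close>, \<open>p\<close> is Borel on
    the whole line as soon as it is continuous on \<open>C\<close>.\<close>
  define p where "p t = (if t \<in> C then p0 t else undefined)" for t
  have p: "\<exists>\<delta>>0. \<forall>x. \<bar>e x - t\<bar> < \<delta> \<longrightarrow> dist x (p t) \<le> \<eta>" if "t \<in> C" "\<eta> > 0" for t \<eta>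
    using p0 that unfolding p_def by auto
  have cont: "continuous_on C p"
    unfolding continuous_on_iff
  proof (intro ballI allI impI)
    fix t and \<eta> :: real assume t: "t \<in> C" and "\<eta> > 0"
    then obtain \<delta> where d: "\<delta> > 0" "\<And>x. \<bar>e x - t\<bar> < \<delta> \<Longrightarrow> dist x (p t) \<le> \<eta>/3" using p[OF t, of "\<eta>/3"] by auto
    show "\<exists>d>0. \<forall>s\<in>C. dist s t < d \<longrightarrow> dist (p s) (p t) < \<eta>"
    proof (intro exI[of _ "\<delta>/2"] conjI ballI impI)
      fix s assume s: "s \<in> C" "dist s t < \<delta>/2"
      obtain \<delta>' where d': "\<delta>' > 0" "\<And>x. \<bar>e x - s\<bar> < \<delta>' \<Longrightarrow> dist x (p s) \<le> \<eta>/3"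
        using p[OF s(1), of "\<eta>/3"] \<open>\<eta> > 0\<close> by auto
      have "0 < min \<delta>' (\<delta>/2)" using d(1) d'(1) by simp
      \<comment> \<open>Codes are dense in \<open>C\<close>, so some genuine point x has a code near
        both s and t and links \<open>p s\<close> to \<open>p t\<close>.\<close>
      then obtain x where x: "dist (e x) s < min \<delta>' (\<delta>/2)"
        using s(1) unfolding C_def closure_approachable by blast
      have "dist x (p s) \<le> \<eta>/3" using x by (intro d') (simp add: dist_real_def)
      moreover have "dist x (p t) \<le> \<eta>/3" using x s(2) unfolding dist_real_def by (intro d) linarith
      ultimately show "dist (p s) (p t) < \<eta>" using dist_triangle3[of "p s" "p t" x] \<open>\<eta> > 0\<close> by auto
    qed (use d in auto)
  qed
  have "closed C" by (simp add: C_def)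
  have eC: "e x \<in> C" for x unfolding C_def by (rule subsetD[OF closure_subset]) simp
  have pe: "p (e x) = x" for x
  proof -
    have le: "dist x (p (e x)) \<le> \<eta>" if eta: "\<eta> > 0" for \<eta>
    proof -
      obtain \<delta> where "\<delta> > 0" "\<And>y. \<bar>e y - e x\<bar> < \<delta> \<Longrightarrow> dist y (p (e x)) \<le> \<eta>" using p[OF eC eta] by blast
      then show ?thesis by simp
    qed
    have "\<not> dist x (p (e x)) > 0" using le[of "dist x (p (e x)) / 2"] by linarith
    then show ?thesis by simp
  qed
  have "p \<in> borel \<rightarrow>\<^sub>M borel"
  proof -
    have "(\<lambda>t. if t \<in> C then p t else undefined) \<in> borel \<rightarrow>\<^sub>M borel"
      by (rule borel_measurable_continuous_on_if) (use cont \<open>closed C\<close> in auto)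
    moreover have "(\<lambda>t. if t \<in> C then p t else undefined) = p" by (auto simp: p_def)
    ultimately show ?thesis by simp
  qed
  show thesis
    by (rule that[OF e(1,2) \<open>closed C\<close> eC cont pe \<open>p \<in> borel \<rightarrow>\<^sub>M borel\<close>])
qed

section \<open>Continuous functions and finite Borel measures on a compact space\<close>

lemma continuous_bounded_on_compact_type:
  fixes f :: "'a::metric_space \<Rightarrow> real"
  assumes "compact (UNIV :: 'a set)" "continuous_on UNIV f"
  obtains B where "B \<ge> 0" "\<And>x. \<bar>f x\<bar> \<le> B"
proof -
  have "bounded (range f)" using compact_imp_bounded[OF compact_continuous_image[OF assms(2,1)]] .
  then obtain B where "\<And>x. \<bar>f x\<bar> \<le> B" unfolding bounded_iff by auto
  then show thesis using that[of B] order_trans[OF abs_ge_zero] by blast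
qed

lemma continuous_integrable:
  fixes f :: "'a::metric_space \<Rightarrow> real"
  assumes "compact (UNIV :: 'a set)" "\<nu> \<in> nonneg_measures" "continuous_on UNIV f"
  shows "integrable \<nu> f"
proof -
  interpret finite_measure \<nu> using assms(2) by (simp add: nonneg_measures_def)
  obtain B where B: "\<And>x. \<bar>f x\<bar> \<le> B" using continuous_bounded_on_compact_type[OF assms(1,3)] by blast
  have "f \<in> borel_measurable borel" using assms(3) by (rule borel_measurable_continuous_onI)
  moreover have "sets \<nu> = sets borel" using assms(2) by (simp add: nonneg_measures_def)
  ultimately have fm: "f \<in> borel_measurable \<nu>" using measurable_cong_sets[of \<nu> borel borel borel] by simp
  show ?thesis by (rule integrable_const_bound[OF _ fm, of B]) (simp add: B)
qed

lemma prob_subset_nonneg: "prob_measures \<subseteq> nonneg_measures"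
  using prob_space.finite_measure by (auto simp: prob_measures_def nonneg_measures_def)

lemma continuous_as_bcontfun:
  fixes f :: "'a::metric_space \<Rightarrow> real"
  assumes "compact (UNIV :: 'a set)" "continuous_on UNIV f"
  obtains \<phi> :: "'a \<Rightarrow>\<^sub>C real" where "apply_bcontfun \<phi> = f"
proof -
  have "f \<in> bcontfun"
    using compact_imp_bounded[OF compact_continuous_image[OF assms(2,1)]] assms(2) by (simp add: bcontfun_def)
  then show thesis using that Bcontfun_inverse by blast
qed

text \<open>The indicator of a closed set C is the pointwise limit of max 0 (1 - n infdist x C), and
  the closed sets form an intersection-stable generator of the Borel sets.\<close>

lemma measure_eqI_continuous:
  fixes \<mu> \<nu> :: "'a::metric_space measure"
  assumes "compact (UNIV :: 'a set)" "\<mu> \<in> nonneg_measures" "\<nu> \<in> nonneg_measures"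
    and eq: "\<And>f :: 'a \<Rightarrow> real. continuous_on UNIV f \<Longrightarrow> (\<integral>x. f x \<partial>\<mu>) = (\<integral>x. f x \<partial>\<nu>)"
  shows "\<mu> = \<nu>"
proof -
  interpret \<mu>: finite_measure \<mu> using assms(2) by (simp add: nonneg_measures_def)
  interpret \<nu>: finite_measure \<nu> using assms(3) by (simp add: nonneg_measures_def)
  have sets: "sets \<mu> = sets borel" "sets \<nu> = sets borel" using assms by (auto simp: nonneg_measures_def)
  have closed_eq: "emeasure \<mu> C = emeasure \<nu> C" if C: "closed C" for C
  \<comment> \<open>\<open>infdist\<close> to the empty set is 0 by convention, so the approximating
    functions would all be 1 there instead of tending to the indicator.\<close>
  proof (cases "C = {}")
    case False
    define f where "f n x = max 0 (1 - real n * infdist x C)" for n x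
    have f: "continuous_on UNIV (f n)" for n unfolding f_def by (intro continuous_intros)
    have f1: "norm (f n x) \<le> 1" for n x unfolding f_def by (auto simp: infdist_nonneg max_def)
    have lim: "(\<lambda>n. f n x) \<longlonglongrightarrow> indicat_real C x" for x
    proof (cases "x \<in> C")
      case True
      then show ?thesis by (simp add: f_def)
    next
      case x: False
      then have pos: "infdist x C > 0" using in_closed_iff_infdist_zero[OF C False, of x] infdist_nonneg[of x C] by linarith
      obtain N where N: "1 < real N * infdist x C" using reals_Archimedean3[OF pos] by blast
      have "\<forall>\<^sub>F n in sequentially. f n x = 0"
        unfolding eventually_sequentially
      proof (intro exI allI impI)
        fix n assume "N \<le> n"
        then have "real N * infdist x C \<le> real n * infdist x C" using pos by (intro mult_right_mono) auto
        then show "f n x = 0" using N by (simp add: f_def)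
      qed
      then show ?thesis using x by (simp add: tendsto_eventually)
    qed
    have conv: "(\<lambda>n. \<integral>x. f n x \<partial>M) \<longlonglongrightarrow> measure M C" if M: "finite_measure M" "sets M = sets borel" for M
    proof -
      interpret finite_measure M by fact
      have "(\<lambda>n. \<integral>x. f n x \<partial>M) \<longlonglongrightarrow> (\<integral>x. indicat_real C x \<partial>M)"
      proof (rule integral_dominated_convergence[where w = "\<lambda>_. 1"])
        show "indicat_real C \<in> borel_measurable M" using C M(2) by (simp add: borel_measurable_indicator)
        show "f n \<in> borel_measurable M" for n
          unfolding measurable_cong_sets[OF M(2) refl] by (rule borel_measurable_continuous_onI[OF f])
      qed (use lim f1 in auto)
      moreover have "C \<in> sets M" "C \<inter> space M = C" using C M sets_eq_imp_space_eq[OF M(2)] by auto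
      ultimately show ?thesis by simp
    qed
    have "measure \<mu> C = measure \<nu> C"
      using LIMSEQ_unique[OF conv[OF \<mu>.finite_measure_axioms sets(1)]] conv[OF \<nu>.finite_measure_axioms sets(2)] eq[OF f] by auto
    then show ?thesis by (simp add: \<mu>.emeasure_eq_measure \<nu>.emeasure_eq_measure)
  qed simp
  show ?thesis
  proof (rule measure_eqI_generator_eq[where \<Omega> = UNIV and E = "Collect closed" and A = "\<lambda>_. UNIV"])
    show "sets \<mu> = sigma_sets UNIV (Collect closed)" "sets \<nu> = sigma_sets UNIV (Collect closed)"
      unfolding sets borel_eq_closed by simp_all
    show "emeasure \<mu> (UNIV) \<noteq> \<infinity>" by simp
  qed (auto simp: Int_stable_def closed_eq)
qed

text \<open>
  The class \<open>metric_space\<close> does not include second countability, so continuity does not yield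
  measurability for the product sigma-algebra at once; \<open>k\<close> is a limit of kernels that are
  countably valued in the first argument.
\<close>

lemma continuous_measurable_pair:
  fixes k :: "'a::metric_space \<Rightarrow> 'a \<Rightarrow> real"
  assumes "compact (UNIV :: 'a set)" "continuous_on UNIV (\<lambda>(x, y). k x y)"
  shows "(\<lambda>(x, y). k x y) \<in> borel_measurable (borel \<Otimes>\<^sub>M borel)"
proof -
  have cont1: "continuous_on UNIV (\<lambda>y. k x y)" "continuous_on UNIV (\<lambda>x. k x y)" for x y
  proof -
    have p: "continuous_on UNIV (\<lambda>y. (x, y))" "continuous_on UNIV (\<lambda>x. (x, y))" by (intro continuous_intros)+
    show "continuous_on UNIV (\<lambda>y. k x y)" "continuous_on UNIV (\<lambda>x. k x y)"
      using continuous_on_compose2[OF assms(2) p(1)] continuous_on_compose2[OF assms(2) p(2)] by simp_all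
  qed
  obtain U :: "nat \<Rightarrow> 'a set" where U: "\<And>i. open (U i)"
    "\<And>\<eta>. \<eta> > 0 \<Longrightarrow> \<exists>N. \<forall>x. \<exists>j\<le>N. x \<in> U j \<and> (\<forall>y\<in>U j. dist x y < \<eta>)"
    using compact_countable_ball_family[OF assms(1)] by metis
  define d where "d i = (SOME x. x \<in> U i)" for i
  have dense: "\<exists>i. dist x (d i) < \<eta>" if "\<eta> > 0" for x \<eta>
  proof -
    obtain j where j: "x \<in> U j" "\<forall>y\<in>U j. dist x y < \<eta>" using U(2)[OF \<open>\<eta> > 0\<close>] by blast
    then have "d j \<in> U j" unfolding d_def by (metis someI)
    then show ?thesis using j by blast
  qed
  \<comment> \<open>This rounds x to the first point of a dense sequence within 1 / Suc n. For each
    of the countably many values of \<open>J n\<close> the rounded kernel depends on the second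
    argument only, which makes it measurable for the product.\<close>
  define J where "J n x = (LEAST i. dist x (d i) < 1 / Suc n)" for n x
  have J: "dist x (d (J n x)) < 1 / Suc n" for n x
    unfolding J_def by (rule LeastI_ex[OF dense]) simp
  have mJ: "J n \<in> borel \<rightarrow>\<^sub>M count_space UNIV" for n
  proof -
    have [measurable]: "(\<lambda>x. dist x (d i)) \<in> borel_measurable borel" for i
      by (intro borel_measurable_continuous_onI continuous_intros)
    show ?thesis unfolding J_def by measurable
  qed
  have mk[measurable]: "k x \<in> borel_measurable borel" for x
    by (rule borel_measurable_continuous_onI[OF cont1(1)])
  have "(\<lambda>z. k (fst z) (snd z)) \<in> borel_measurable (borel \<Otimes>\<^sub>M borel)"
  proof (rule borel_measurable_LIMSEQ_real)
    show "(\<lambda>n. k (d (J n (fst z))) (snd z)) \<longlonglongrightarrow> k (fst z) (snd z)" for z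
    proof -
      have "(\<lambda>n. d (J n (fst z))) \<longlonglongrightarrow> fst z"
      proof (rule metric_tendsto_imp_tendsto[OF LIMSEQ_inverse_real_of_nat])
        show "\<forall>\<^sub>F n in sequentially. dist (d (J n (fst z))) (fst z) \<le> dist (inverse (real (Suc n))) 0"
          using J[of "fst z"] by (simp add: dist_commute inverse_eq_divide less_imp_le)
      qed
      then show ?thesis by (rule continuous_on_tendsto_compose[OF cont1(2)]) auto
    qed
    show "(\<lambda>z. k (d (J n (fst z))) (snd z)) \<in> borel_measurable (borel \<Otimes>\<^sub>M borel)" for n
      by (rule measurable_compose_countable[OF _ measurable_compose[OF measurable_fst mJ]]) measurable
  qed
  then show ?thesis by (simp add: case_prod_beta)
qed

text \<open>All codes lie in \<open>C\<close>, so testing against the distance to \<open>C\<close>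
  shows that the limit law \<sigma> is carried by \<open>C\<close>. There f composed with
  \<open>p\<close> is continuous, and its Tietze extension to the line is an admissible test
  function for convergence in law that returns f on codes.\<close>

lemma weak_limit_decode:
  fixes e f :: "'a::metric_space \<Rightarrow> real"
  assumes e: "e \<in> borel_measurable borel" "\<And>x. 0 \<le> e x \<and> e x \<le> 1"
    and C: "closed C" "\<And>x. e x \<in> C" "continuous_on C p" "\<And>x. p (e x) = x" "p \<in> borel \<rightarrow>\<^sub>M borel"
    and compact: "compact (UNIV :: 'a set)"
    and \<mu>: "\<And>n. \<mu> n \<in> prob_measures" and \<sigma>: "real_distribution \<sigma>"
    and conv: "weak_conv_m (\<lambda>n. distr (\<mu> n) borel e) \<sigma>"
    and f: "continuous_on UNIV f"
  shows "(\<lambda>n. \<integral>x. f x \<partial>\<mu> n) \<longlonglongrightarrow> (\<integral>x. f x \<partial>distr \<sigma> borel p)"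
proof -
  interpret \<sigma>: real_distribution \<sigma> by fact
  have s\<mu>[measurable_cong]: "sets (\<mu> n) = sets borel" for n using \<mu> by (simp add: prob_measures_def)
  have p\<mu>: "prob_space (\<mu> n)" for n using \<mu> by (simp add: prob_measures_def)
  note [measurable] = e(1) C(5)
  have rd: "real_distribution (distr (\<mu> n) borel e)" for n
    using prob_space.real_distribution_distr[OF p\<mu>] by measurable
  have push: "(\<integral>t. g t \<partial>distr (\<mu> n) borel e) = (\<integral>x. g (e x) \<partial>\<mu> n)" if "continuous_on UNIV g" for g :: "real \<Rightarrow> real" and n
  proof (rule integral_distr)
    show "e \<in> \<mu> n \<rightarrow>\<^sub>M borel" by measurable
    show "g \<in> borel_measurable borel" by (rule borel_measurable_continuous_onI[OF that])
  qed
  have lim: "(\<lambda>n. \<integral>x. g (e x) \<partial>\<mu> n) \<longlonglongrightarrow> (\<integral>t. g t \<partial>\<sigma>)"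
    if g: "continuous_on UNIV g" "\<And>t. norm (g t) \<le> B" for g :: "real \<Rightarrow> real" and B
  proof -
    have "isCont g t" for t using g(1) by (simp add: continuous_on_eq_continuous_at)
    from weak_conv_imp_integral_bdd_continuous_conv[OF rd \<sigma> conv this g(2)]
    show ?thesis by (simp add: push[OF g(1)])
  qed
  have "C \<noteq> {}" using C(2) by auto
  have "AE t in \<sigma>. t \<in> C"
  proof -
    \<comment> \<open>The truncation at 1 makes the distance bounded, as convergence in law
      requires, without changing its zero set \<open>C\<close>.\<close>
    define h where "h t = min 1 (infdist t C)" for t
    have h: "continuous_on UNIV h" unfolding h_def by (intro continuous_intros)
    have h01: "0 \<le> h t" "h t \<le> 1" for t by (auto simp: h_def infdist_nonneg)
    have "(\<lambda>n. \<integral>x. h (e x) \<partial>\<mu> n) \<longlonglongrightarrow> (\<integral>t. h t \<partial>\<sigma>)" by (rule lim[OF h, of 1]) (use h01 in auto)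
    moreover have "h (e x) = 0" for x using C(2) by (simp add: h_def)
    ultimately have "(\<integral>t. h t \<partial>\<sigma>) = 0" by (simp add: LIMSEQ_const_iff)
    moreover have "integrable \<sigma> h"
      by (rule \<sigma>.integrable_const_bound[where B = 1]) (use h01 borel_measurable_continuous_onI[OF h] in auto)
    ultimately have "AE t in \<sigma>. h t = 0" using integral_nonneg_eq_0_iff_AE[of \<sigma> h] h01 by auto
    then show ?thesis
      by eventually_elim (use in_closed_iff_infdist_zero[OF C(1) \<open>C \<noteq> {}\<close>] in \<open>simp add: h_def min_def split: if_splits\<close>)
  qed
  obtain B where B: "B \<ge> 0" "\<And>x. \<bar>f x\<bar> \<le> B" using continuous_bounded_on_compact_type[OF compact f] by blast
  have fp: "continuous_on C (\<lambda>t. f (p t))" by (rule continuous_on_compose2[OF f C(3)]) simp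
  obtain g :: "real \<Rightarrow> real" where g: "continuous_on UNIV g" "\<And>t. t \<in> C \<Longrightarrow> g t = f (p t)" "\<And>t. norm (g t) \<le> B"
    using Tietze[OF fp _ B(1), of UNIV] C(1) B(2) by auto
  have "(\<lambda>n. \<integral>x. g (e x) \<partial>\<mu> n) \<longlonglongrightarrow> (\<integral>t. g t \<partial>\<sigma>)" by (rule lim[OF g(1,3)])
  also have "(\<lambda>n. \<integral>x. g (e x) \<partial>\<mu> n) = (\<lambda>n. \<integral>x. f x \<partial>\<mu> n)" using g(2) C(2,4) by simp
  also have "(\<integral>t. g t \<partial>\<sigma>) = (\<integral>t. f (p t) \<partial>\<sigma>)"
    by (rule integral_cong_AE)
       (use borel_measurable_continuous_onI[OF g(1)] borel_measurable_continuous_onI[OF f] \<open>AE t in \<sigma>. t \<in> C\<close> g(2)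
         measurable_compose[OF C(5)] in auto)
  also have "\<dots> = (\<integral>x. f x \<partial>distr \<sigma> borel p)"
    by (rule integral_distr[symmetric]) (use borel_measurable_continuous_onI[OF f] C(5) in auto)
  finally show ?thesis .
qed

theorem prob_measures_sequentially_compact:
  fixes \<mu> :: "nat \<Rightarrow> 'a::metric_space measure"
  assumes compact: "compact (UNIV :: 'a set)" and \<mu>: "\<And>n. \<mu> n \<in> prob_measures"
  obtains r \<nu> where "strict_mono (r :: nat \<Rightarrow> nat)" "\<nu> \<in> prob_measures"
    "\<And>f :: 'a \<Rightarrow> real. continuous_on UNIV f \<Longrightarrow> (\<lambda>n. \<integral>x. f x \<partial>\<mu> (r n)) \<longlonglongrightarrow> (\<integral>x. f x \<partial>\<nu>)"
proof -
  obtain e :: "'a \<Rightarrow> real" and p C where e: "e \<in> borel_measurable borel" "\<And>x. 0 \<le> e x \<and> e x \<le> 1"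
    and C: "closed C" "\<And>x. e x \<in> C" "continuous_on C p" "\<And>x. p (e x) = x" "p \<in> borel \<rightarrow>\<^sub>M borel"
    using borel_code_with_continuous_decoding[OF compact] by metis
  note [measurable] = e(1) C(5)
  have s\<mu>[measurable_cong]: "sets (\<mu> n) = sets borel" for n using \<mu> by (simp add: prob_measures_def)
  have p\<mu>: "prob_space (\<mu> n)" for n using \<mu> by (simp add: prob_measures_def)
  have rd: "real_distribution (distr (\<mu> n) borel e)" for n
    using prob_space.real_distribution_distr[OF p\<mu>] by measurable
  have "tight (\<lambda>n. distr (\<mu> n) borel e)"
    unfolding tight_def
  proof (intro conjI allI impI)
    fix \<epsilon> :: real assume "\<epsilon> > 0"
    \<comment> \<open>All codes lie in [0, 1], so one interval serves every n and \<epsilon>.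
      Tightness is stated with intervals open on the left, and 0 may be a code; hence the endpoint
      -1.\<close>
    have "measure (distr (\<mu> n) borel e) {-1<..1} = 1" for n
    proof -
      have "e -` {-1<..1} \<inter> space (\<mu> n) = space (\<mu> n)" using e(2) by (fastforce simp: less_le_trans[of "-1::real" 0])
      then show ?thesis using prob_space.prob_space[OF p\<mu>] by (subst measure_distr) auto
    qed
    then show "\<exists>a b. a < b \<and> (\<forall>n. 1 - \<epsilon> < measure (distr (\<mu> n) borel e) {a<..b})"
      using \<open>\<epsilon> > 0\<close> by (intro exI[of _ "-1"] exI[of _ 1]) simp
  qed (rule rd)
  from tight_imp_convergent_subsubsequence[OF this strict_mono_id]
  obtain r \<sigma> where r: "strict_mono r" and \<sigma>: "real_distribution \<sigma>"
    and conv: "weak_conv_m (\<lambda>n. distr (\<mu> (r n)) borel e) \<sigma>" by (auto simp: comp_def)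
  interpret \<sigma>: real_distribution \<sigma> by fact
  have "prob_space (distr \<sigma> borel p)" by (rule \<sigma>.prob_space_distr) measurable
  then have "distr \<sigma> borel p \<in> prob_measures" by (simp add: prob_measures_def)
  then show thesis
    using that[OF r] weak_limit_decode[OF e C compact \<mu> \<sigma> conv] by blast
qed

section \<open>The weak-* topology\<close>

lemma topspace_weak_star: "topspace weak_star = nonneg_measures"
  by (simp add: weak_star_def topspace_pullback_topology)

lemma continuous_map_into_weak_star:
  fixes T :: "'b \<Rightarrow> 'a::metric_space measure"
  assumes "T \<in> topspace X \<rightarrow> nonneg_measures"
    and "\<And>f :: 'a \<Rightarrow> real. continuous_on UNIV f \<Longrightarrow> continuous_map X euclideanreal (\<lambda>z. \<integral>x. f x \<partial>T z)"
  shows "continuous_map X weak_star T"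
  unfolding weak_star_def
proof (rule continuous_map_pullback')
  have "continuous_on UNIV (apply_bcontfun \<phi>)" for \<phi> :: "'a \<Rightarrow>\<^sub>C real"
    using apply_bcontfun[of \<phi>] by (simp add: bcontfun_def)
  then show "continuous_map X (product_topology (\<lambda>_ :: 'a \<Rightarrow>\<^sub>C real. euclideanreal) UNIV)
      ((\<lambda>\<nu> \<phi>. \<integral>x. apply_bcontfun \<phi> x \<partial>\<nu>) \<circ> T)"
    unfolding continuous_map_componentwise_UNIV comp_def by (intro allI assms(2))
  show "topspace X \<subseteq> T -` nonneg_measures" using assms(1) by auto
qed

text \<open>Measures are determined by their integrals of continuous functions, so the map that
  defines the topology is injective into a Hausdorff product.\<close>

lemma Hausdorff_weak_star:
  assumes "compact (UNIV :: 'a::metric_space set)"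
  shows "Hausdorff_space (weak_star :: 'a measure topology)"
proof (rule Hausdorff_space_injective_preimage)
  let ?I = "\<lambda>(\<nu> :: 'a measure) (\<phi> :: 'a \<Rightarrow>\<^sub>C real). \<integral>x. apply_bcontfun \<phi> x \<partial>\<nu>"
  show "Hausdorff_space (product_topology (\<lambda>_ :: 'a \<Rightarrow>\<^sub>C real. euclideanreal) UNIV)"
    by (simp add: Hausdorff_space_product_topology)
  have "continuous_map weak_star (product_topology (\<lambda>_ :: 'a \<Rightarrow>\<^sub>C real. euclideanreal) UNIV) (id \<circ> ?I)"
    unfolding weak_star_def by (intro continuous_map_pullback continuous_map_id)
  then show "continuous_map weak_star (product_topology (\<lambda>_ :: 'a \<Rightarrow>\<^sub>C real. euclideanreal) UNIV) ?I"
    by simp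
  show "inj_on ?I (topspace weak_star)"
  proof (rule inj_onI)
    fix \<mu> \<nu> :: "'a measure"
    assume \<mu>: "\<mu> \<in> topspace weak_star" "\<nu> \<in> topspace weak_star" and eq: "?I \<mu> = ?I \<nu>"
    show "\<mu> = \<nu>"
    proof (rule measure_eqI_continuous[OF assms])
      show "\<mu> \<in> nonneg_measures" "\<nu> \<in> nonneg_measures" using \<mu> by (simp_all add: topspace_weak_star)
      fix f :: "'a \<Rightarrow> real" assume "continuous_on UNIV f"
      then obtain \<phi> :: "'a \<Rightarrow>\<^sub>C real" where "apply_bcontfun \<phi> = f" using continuous_as_bcontfun[OF assms] by metis
      then show "(\<integral>x. f x \<partial>\<mu>) = (\<integral>x. f x \<partial>\<nu>)" using fun_cong[OF eq, of \<phi>] by simp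
    qed
  qed
qed

section \<open>The Riesz representation theorem\<close>

locale hilbert_functions =
  fixes H :: "('a \<Rightarrow> real) set" and ip :: "('a \<Rightarrow> real) \<Rightarrow> ('a \<Rightarrow> real) \<Rightarrow> real"
  assumes hilbert: "hilbert_function_space H ip"
begin

lemma zero_mem: "(\<lambda>x. 0) \<in> H"
  and comb_mem: "f \<in> H \<Longrightarrow> g \<in> H \<Longrightarrow> (\<lambda>x. a * f x + b * g x) \<in> H"
  and ip_sym: "f \<in> H \<Longrightarrow> g \<in> H \<Longrightarrow> ip f g = ip g f"
  and ip_comb: "f \<in> H \<Longrightarrow> g \<in> H \<Longrightarrow> h \<in> H \<Longrightarrow> ip (\<lambda>x. a * f x + b * g x) h = a * ip f h + b * ip g h"
  and ip_nonneg: "f \<in> H \<Longrightarrow> 0 \<le> ip f f"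
  and ip_definite: "f \<in> H \<Longrightarrow> ip f f = 0 \<Longrightarrow> f = (\<lambda>x. 0)"
  and complete: "Metric_space.mcomplete H (ip_dist H ip)"
  using hilbert unfolding hilbert_function_space_def by blast+

lemma diff_mem: "f \<in> H \<Longrightarrow> g \<in> H \<Longrightarrow> (\<lambda>x. f x - g x) \<in> H"
  using comb_mem[of f g 1 "-1"] by simp

lemma ip_diff: "f \<in> H \<Longrightarrow> g \<in> H \<Longrightarrow> h \<in> H \<Longrightarrow> ip (\<lambda>x. f x - g x) h = ip f h - ip g h"
  using ip_comb[of f g h 1 "-1"] by simp

lemma ip_comb_self:
  assumes "f \<in> H" "g \<in> H"
  shows "ip (\<lambda>x. a * f x + b * g x) (\<lambda>x. a * f x + b * g x) = a\<^sup>2 * ip f f + 2 * a * b * ip f g + b\<^sup>2 * ip g g"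
proof -
  have "ip h (\<lambda>x. a * f x + b * g x) = a * ip h f + b * ip h g" if "h \<in> H" for h
    using assms that by (simp add: ip_sym[OF that] comb_mem ip_comb)
  then show ?thesis
    using assms by (simp add: comb_mem ip_comb ip_sym[of g f] power2_eq_square algebra_simps)
qed

lemma ip_diff_self:
  "f \<in> H \<Longrightarrow> g \<in> H \<Longrightarrow> ip (\<lambda>x. f x - g x) (\<lambda>x. f x - g x) = ip f f - 2 * ip f g + ip g g"
  using ip_comb_self[of f g 1 "-1"] by simp

lemma ip_zero: "f \<in> H \<Longrightarrow> ip (\<lambda>x. 0) f = 0"
  using ip_comb[of f f f 0 0] by simp

lemma ip_norm_nonneg: "f \<in> H \<Longrightarrow> 0 \<le> ip_norm ip f"
  by (simp add: ip_norm_def ip_nonneg)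

lemma ip_norm_power2: "f \<in> H \<Longrightarrow> (ip_norm ip f)\<^sup>2 = ip f f"
  by (simp add: ip_norm_def ip_nonneg)

lemma cauchy_schwarz:
  assumes "f \<in> H" "g \<in> H"
  shows "\<bar>ip f g\<bar> \<le> ip_norm ip f * ip_norm ip g"
proof (cases "ip g g = 0")
  case True
  then have "g = (\<lambda>x. 0)" by (rule ip_definite[OF assms(2)])
  then have "ip f g = 0" using ip_sym[OF assms] ip_zero[OF assms(1)] by simp
  then show ?thesis using assms by (simp add: ip_norm_nonneg)
next
  case False
  then have pos: "ip g g > 0" using ip_nonneg[OF assms(2)] by simp
  have "0 \<le> ip (\<lambda>x. ip g g * f x + (- ip f g) * g x) (\<lambda>x. ip g g * f x + (- ip f g) * g x)"
    by (rule ip_nonneg[OF comb_mem[OF assms]])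
  also have "\<dots> = ip g g * (ip g g * ip f f - (ip f g)\<^sup>2)"
    by (subst ip_comb_self[OF assms]) (simp add: power2_eq_square algebra_simps)
  finally have "(ip f g)\<^sup>2 \<le> ip f f * ip g g" using pos by (simp add: zero_le_mult_iff mult.commute)
  then have "\<bar>ip f g\<bar> \<le> sqrt (ip f f * ip g g)" by (intro real_le_rsqrt) simp
  then show ?thesis by (simp add: ip_norm_def real_sqrt_mult)
qed

lemma ip_dist_eq: "f \<in> H \<Longrightarrow> g \<in> H \<Longrightarrow> ip_dist H ip f g = ip_norm ip (\<lambda>x. f x - g x)"
  by (simp add: ip_dist_def)

lemma ip_dist_power2: "f \<in> H \<Longrightarrow> g \<in> H \<Longrightarrow> (ip_dist H ip f g)\<^sup>2 = ip f f - 2 * ip f g + ip g g"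
  by (simp add: ip_dist_eq ip_norm_power2 diff_mem ip_diff_self)

lemma ip_norm_triangle:
  assumes "f \<in> H" "g \<in> H"
  shows "ip_norm ip (\<lambda>x. f x + g x) \<le> ip_norm ip f + ip_norm ip g"
proof (rule power2_le_imp_le)
  have mem: "(\<lambda>x. f x + g x) \<in> H" using comb_mem[OF assms, of 1 1] by simp
  have "(ip_norm ip (\<lambda>x. f x + g x))\<^sup>2 = ip f f + 2 * ip f g + ip g g"
    using ip_comb_self[OF assms, of 1 1] by (simp add: ip_norm_power2[OF mem])
  then show "(ip_norm ip (\<lambda>x. f x + g x))\<^sup>2 \<le> (ip_norm ip f + ip_norm ip g)\<^sup>2"
    using cauchy_schwarz[OF assms] ip_norm_power2[OF assms(1)] ip_norm_power2[OF assms(2)]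
    by (simp add: power2_sum)
  show "0 \<le> ip_norm ip f + ip_norm ip g" using assms by (simp add: ip_norm_nonneg)
qed

sublocale M: Metric_space H "ip_dist H ip"
proof
  fix f g h
  show "0 \<le> ip_dist H ip f g" by (simp add: ip_dist_def ip_norm_nonneg diff_mem)
  show "ip_dist H ip f g = ip_dist H ip g f"
    using ip_dist_power2[of f g] ip_dist_power2[of g f] ip_sym[of f g]
    by (cases "f \<in> H \<and> g \<in> H") (auto simp: ip_dist_def ip_norm_def ip_diff_self)
  assume fg: "f \<in> H" "g \<in> H"
  show "ip_dist H ip f g = 0 \<longleftrightarrow> f = g"
  proof
    assume "ip_dist H ip f g = 0"
    then have "(\<lambda>x. f x - g x) = (\<lambda>x. 0)"
      using fg by (intro ip_definite) (simp_all add: ip_dist_eq ip_norm_def diff_mem)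
    then show "f = g" by (simp add: fun_eq_iff)
  next
    assume "f = g"
    then show "ip_dist H ip f g = 0" using ip_zero[OF zero_mem] fg by (simp add: ip_dist_eq ip_norm_def)
  qed
  assume h: "h \<in> H"
  show "ip_dist H ip f h \<le> ip_dist H ip f g + ip_dist H ip g h"
    using ip_norm_triangle[OF diff_mem[OF fg] diff_mem[OF fg(2) h]] fg h by (simp add: ip_dist_eq)
qed

lemma rkhs_norm_topology_eq: "rkhs_norm_topology H ip = M.mtopology"
  by (simp add: rkhs_norm_topology_def)

lemma tendsto_ip:
  assumes "limitin M.mtopology s g sequentially" "\<And>n. s n \<in> H" "h \<in> H"
  shows "(\<lambda>n. ip (s n) h) \<longlonglongrightarrow> ip g h"
proof -
  have g: "g \<in> H" and d: "(\<lambda>n. ip_dist H ip (s n) g) \<longlonglongrightarrow> 0"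
    using assms(1) by (auto simp: M.limitin_metric_dist_null)
  have le: "norm (ip (s n) h - ip g h) \<le> ip_dist H ip (s n) g * ip_norm ip h" for n
    using cauchy_schwarz[OF diff_mem[OF assms(2) g] assms(3), of n] assms g by (simp add: ip_diff ip_dist_eq)
  then show ?thesis
    by (intro LIM_zero_cancel[OF Lim_null_comparison[OF always_eventually tendsto_mult_left_zero[OF d]]] allI) (rule le)
qed

text \<open>If g represents L, then ip h h - 2 * L h is the squared distance from h to g up to a
  constant; so g is sought as the minimiser. The parallelogram identity makes a minimising sequence
  Cauchy, and the first variation at its limit is the representation formula.\<close>

theorem riesz_representation:
  assumes lin: "\<And>f g a b. f \<in> H \<Longrightarrow> g \<in> H \<Longrightarrow> L (\<lambda>x. a * f x + b * g x) = a * L f + b * L g"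
    and bdd: "\<And>f. f \<in> H \<Longrightarrow> \<bar>L f\<bar> \<le> C * ip_norm ip f"
  obtains g where "g \<in> H" "\<And>h. h \<in> H \<Longrightarrow> ip h g = L h"
proof -
  define J where "J h = ip h h - 2 * L h" for h
  define I where "I = (INF h\<in>H. J h)"
  have J_bound: "- C\<^sup>2 \<le> J h" if "h \<in> H" for h
  proof -
    have "0 \<le> (ip_norm ip h - C)\<^sup>2" by simp
    then show ?thesis using bdd[OF that] ip_norm_power2[OF that] by (simp add: J_def power2_diff abs_le_iff mult.commute)
  qed
  have I_le: "I \<le> J h" if "h \<in> H" for h
    unfolding I_def by (rule cINF_lower[OF bdd_belowI2 that]) (rule J_bound)
  have "\<exists>h\<in>H. J h < I + 1 / Suc n" for n
  proof (rule ccontr)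
    assume "\<not> (\<exists>h\<in>H. J h < I + 1 / Suc n)"
    then have "I + 1 / Suc n \<le> I" unfolding I_def by (intro cINF_greatest) (use zero_mem in force)+
    then show False by simp
  qed
  then obtain s where s: "\<And>n. s n \<in> H" "\<And>n. J (s n) < I + 1 / Suc n" by metis
  have close: "(ip_dist H ip (s n) (s m))\<^sup>2 \<le> 2 / Suc n + 2 / Suc m" for n m
  proof -
    have "4 * I \<le> 4 * J (\<lambda>x. (1/2) * s n x + (1/2) * s m x)" using I_le[OF comb_mem[OF s(1)[of n] s(1)[of m], of "1/2" "1/2"]] by simp
    also have "\<dots> = ip (s n) (s n) + 2 * ip (s n) (s m) + ip (s m) (s m) - 4 * L (s n) - 4 * L (s m)"
      unfolding J_def ip_comb_self[OF s(1) s(1)] lin[OF s(1) s(1)] by (simp add: power2_eq_square)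
    finally have "(ip_dist H ip (s n) (s m))\<^sup>2 \<le> 2 * J (s n) + 2 * J (s m) - 4 * I"
      unfolding ip_dist_power2[OF s(1) s(1)] J_def by simp
    then show ?thesis using s(2)[of n] s(2)[of m] by simp
  qed
  have "M.MCauchy s"
    unfolding M.MCauchy_def
  proof (intro conjI allI impI)
    show "range s \<subseteq> H" using s(1) by auto
    fix \<epsilon> :: real assume "\<epsilon> > 0"
    then obtain N where N: "1 / Suc N < \<epsilon>\<^sup>2 / 4" using nat_approx_posE[of "\<epsilon>\<^sup>2/4"] by auto
    have le: "1 / real (Suc n) \<le> 1 / Suc N" if "N \<le> n" for n using that by (intro divide_left_mono) auto
    have "ip_dist H ip (s n) (s m) < \<epsilon>" if "N \<le> n" "N \<le> m" for n m
      by (rule power_less_imp_less_base[of _ 2]) (use close[of n m] le[OF that(1)] le[OF that(2)] N \<open>\<epsilon> > 0\<close> in auto)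
    then show "\<exists>N. \<forall>n n'. N \<le> n \<longrightarrow> N \<le> n' \<longrightarrow> ip_dist H ip (s n) (s n') < \<epsilon>" by blast
  qed
  then obtain g where lim: "limitin M.mtopology s g sequentially" using complete unfolding M.mcomplete_def by blast
  then have g: "g \<in> H" by (simp add: M.limitin_metric)
  have "ip h g = L h" if h: "h \<in> H" for h
  proof -
    define a where "a = ip g h - L h"
    define q where "q = ip h h"
    have q: "q \<ge> 0" unfolding q_def by (rule ip_nonneg[OF h])
    have ineq: "0 \<le> t\<^sup>2 * q + 2 * t * a" for t
    proof (rule tendsto_lowerbound)
      show "(\<lambda>n. t\<^sup>2 * q + 2 * t * (ip (s n) h - L h) + 1 / Suc n) \<longlonglongrightarrow> t\<^sup>2 * q + 2 * t * a"
      proof -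
        have "(\<lambda>n. t\<^sup>2 * q + 2 * t * (ip (s n) h - L h) + inverse (real (Suc n)))
            \<longlonglongrightarrow> t\<^sup>2 * q + 2 * t * (ip g h - L h) + 0"
          by (intro tendsto_add tendsto_mult tendsto_diff tendsto_const tendsto_ip[OF lim s(1) h]
              LIMSEQ_inverse_real_of_nat)
        then show ?thesis by (simp add: a_def inverse_eq_divide)
      qed
      show "\<forall>\<^sub>F n in sequentially. 0 \<le> t\<^sup>2 * q + 2 * t * (ip (s n) h - L h) + 1 / Suc n"
      proof (intro always_eventually allI)
        fix n
        have "I \<le> J (\<lambda>x. 1 * s n x + t * h x)" by (rule I_le[OF comb_mem[OF s(1) h]])
        also have "\<dots> = J (s n) + (t\<^sup>2 * q + 2 * t * (ip (s n) h - L h))"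
          unfolding J_def ip_comb_self[OF s(1) h] lin[OF s(1) h] q_def by (simp add: algebra_simps)
        finally show "0 \<le> t\<^sup>2 * q + 2 * t * (ip (s n) h - L h) + 1 / Suc n" using s(2)[of n] by simp
      qed
    qed simp
    \<comment> \<open>The choice t = - u turns the inequality into - u^2 (q + 2) \<ge> 0. The
      summand 1 keeps the quotient meaningful when h = 0.\<close>
    define u where "u = a / (q + 1)"
    have a: "a = u * (q + 1)" using q by (simp add: u_def)
    have "0 \<le> - (u\<^sup>2 * (q + 2))" using ineq[of "- u"] by (simp add: a power2_eq_square algebra_simps)
    then have "u = 0" using q by (simp add: mult_le_0_iff)
    then have "a = 0" by (simp add: a)
    then show ?thesis using ip_sym[OF h g] by (simp add: a_def)
  qed
  then show thesis using that g by blast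
qed

end

section \<open>Mean embeddings\<close>

lemma abs_integral_le:
  fixes f :: "'a::metric_space \<Rightarrow> real"
  assumes "compact (UNIV :: 'a set)" "\<nu> \<in> nonneg_measures" "continuous_on UNIV f" "\<And>x. \<bar>f x\<bar> \<le> B"
  shows "\<bar>\<integral>x. f x \<partial>\<nu>\<bar> \<le> B * measure \<nu> UNIV"
proof -
  interpret finite_measure \<nu> using assms(2) by (simp add: nonneg_measures_def)
  have sp: "space \<nu> = UNIV" using assms(2) sets_eq_imp_space_eq[of \<nu> borel] by (simp add: nonneg_measures_def)
  have "\<bar>\<integral>x. f x \<partial>\<nu>\<bar> \<le> (\<integral>x. \<bar>f x\<bar> \<partial>\<nu>)" by (rule integral_abs_bound)
  also have "\<dots> \<le> (\<integral>x. B \<partial>\<nu>)"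
    by (intro integral_mono continuous_integrable[OF assms(1,2)] continuous_intros assms(3,4))
  finally show ?thesis by (simp add: sp mult.commute)
qed

locale positive_kernel_rkhs =
  fixes k :: "'a::metric_space \<Rightarrow> 'a \<Rightarrow> real"
    and H :: "('a \<Rightarrow> real) set" and ip :: "('a \<Rightarrow> real) \<Rightarrow> ('a \<Rightarrow> real) \<Rightarrow> real"
  assumes cpt: "compact (UNIV :: 'a set)"
    and k_cont: "continuous_on UNIV (\<lambda>(x, y). k x y)"
    and k_pos: "\<And>x y. 0 < k x y"
    and k_le_1: "\<And>x y. k x y \<le> 1"
    and rkhs: "is_rkhs k H ip"
    and dense: "dense_in_continuous H"
begin

abbreviation "K \<equiv> mean_embedding k"

sublocale hilbert_functions H ip
  using rkhs by unfold_locales (simp add: is_rkhs_def)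

lemma k_mem: "k x \<in> H" and reproducing: "f \<in> H \<Longrightarrow> ip f (k x) = f x"
  using rkhs by (simp_all add: is_rkhs_def)

lemma k_sym: "k x y = k y x"
  using ip_sym[OF k_mem k_mem, of x y] by (simp add: reproducing k_mem)

lemma continuous_mem: "f \<in> H \<Longrightarrow> continuous_on UNIV f"
  using dense by (simp add: dense_in_continuous_def)

text \<open>The norm of \<open>k x\<close> is the square root of k x x, hence at most 1. So
  convergence in the norm of H is uniform convergence with the same rate.\<close>

lemma abs_le_ip_norm: "f \<in> H \<Longrightarrow> \<bar>f x\<bar> \<le> ip_norm ip f"
proof -
  assume f: "f \<in> H"
  have "ip_norm ip (k x) \<le> 1" by (simp add: ip_norm_def reproducing k_mem k_le_1)
  then have "ip_norm ip f * ip_norm ip (k x) \<le> ip_norm ip f" by (rule mult_left_le) (rule ip_norm_nonneg[OF f])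
  then show ?thesis using cauchy_schwarz[OF f k_mem, of x] by (simp add: reproducing f)
qed

lemma approximation:
  assumes "continuous_on UNIV f" "\<eta> > 0"
  obtains h where "h \<in> H" "\<And>x. \<bar>f x - h x\<bar> \<le> \<eta>"
proof -
  obtain \<phi> :: "'a \<Rightarrow>\<^sub>C real" where \<phi>: "apply_bcontfun \<phi> = f" using continuous_as_bcontfun[OF cpt assms(1)] .
  have "\<phi> \<in> closure {\<phi>. apply_bcontfun \<phi> \<in> H}" using dense by (simp add: dense_in_continuous_def)
  then obtain \<psi> where \<psi>: "apply_bcontfun \<psi> \<in> H" "dist \<psi> \<phi> < \<eta>"
    using assms(2) unfolding closure_approachable by blast
  have "\<bar>f x - apply_bcontfun \<psi> x\<bar> \<le> \<eta>" for x
    using dist_bounded[of \<phi> x \<psi>] \<psi>(2) by (simp add: \<phi> dist_real_def dist_commute)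
  then show thesis by (rule that[OF \<psi>(1)])
qed

text \<open>The constant m controls everything later: masses on \<A> lie between 1 and 1 / m, values
  on \<B> between m and 1 / m.\<close>

lemma kernel_lower_bound: obtains m where "m > 0" "\<And>x y. m \<le> k x y"
proof -
  have "compact (UNIV :: ('a \<times> 'a) set)" using compact_Times[OF cpt cpt] by simp
  from continuous_attains_inf[OF this _ k_cont] obtain z where "\<And>w. (\<lambda>(x, y). k x y) z \<le> (\<lambda>(x, y). k x y) w" by auto
  then have "k (fst z) (snd z) \<le> k x y" for x y by (metis case_prod_beta fst_conv snd_conv)
  then show thesis using that k_pos by blast
qed

lemma kernel_equicontinuous:
  assumes "\<eta> > 0"
  obtains \<delta> where "\<delta> > 0" "\<And>x y z. dist y z < \<delta> \<Longrightarrow> \<bar>k x y - k x z\<bar> \<le> \<eta>"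
proof -
  have "compact (UNIV :: ('a \<times> 'a) set)" using compact_Times[OF cpt cpt] by simp
  from compact_uniformly_continuous[OF k_cont this] assms
  obtain \<delta> where d: "\<delta> > 0" "\<And>z w. dist z w < \<delta> \<Longrightarrow> dist ((\<lambda>(x, y). k x y) z) ((\<lambda>(x, y). k x y) w) < \<eta>"
    unfolding uniformly_continuous_on_def by blast
  have "\<bar>k x y - k x z\<bar> \<le> \<eta>" if "dist y z < \<delta>" for x y z
    using d(2)[of "(x, y)" "(x, z)"] that by (simp add: dist_Pair_Pair dist_real_def)
  then show thesis using that d(1) by blast
qed

lemma measure_space_UNIV:
  assumes "\<nu> \<in> nonneg_measures"
  shows "finite_measure \<nu>" "sets \<nu> = sets borel" "space \<nu> = UNIV"
  using assms sets_eq_imp_space_eq[of \<nu> borel] by (simp_all add: nonneg_measures_def)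

lemma integral_const_UNIV: "\<nu> \<in> nonneg_measures \<Longrightarrow> (\<integral>x. c \<partial>\<nu>) = c * measure \<nu> UNIV" for c :: real
  by (simp add: measure_space_UNIV(3))

text \<open>Integration against \<nu> is bounded on H because the norm of H dominates the supremum
  norm. Pairing its Riesz representer with k y gives the value at y, which identifies it with the
  defining integral of \<open>K \<nu>\<close>.\<close>

lemma mean_embedding:
  assumes \<nu>: "\<nu> \<in> nonneg_measures"
  shows mean_embedding_mem: "K \<nu> \<in> H"
    and ip_mean_embedding: "h \<in> H \<Longrightarrow> ip h (K \<nu>) = (\<integral>x. h x \<partial>\<nu>)"
proof -
  have int: "integrable \<nu> f" if "f \<in> H" for f by (rule continuous_integrable[OF cpt \<nu> continuous_mem[OF that]])
  have lin: "(\<integral>x. a * f x + b * g x \<partial>\<nu>) = a * (\<integral>x. f x \<partial>\<nu>) + b * (\<integral>x. g x \<partial>\<nu>)" if "f \<in> H" "g \<in> H" for f g a b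
    using int[OF that(1)] int[OF that(2)] by simp
  have bdd: "\<bar>\<integral>x. f x \<partial>\<nu>\<bar> \<le> measure \<nu> UNIV * ip_norm ip f" if "f \<in> H" for f
      using abs_integral_le[OF cpt \<nu> continuous_mem[OF that] abs_le_ip_norm[OF that]] by (simp add: mult.commute)
  obtain g where g: "g \<in> H" "\<And>h. h \<in> H \<Longrightarrow> ip h g = (\<integral>x. h x \<partial>\<nu>)"
    by (rule riesz_representation[of "\<lambda>h. \<integral>x. h x \<partial>\<nu>", OF lin bdd]) (assumption | blast intro: that)+
  have "g y = K \<nu> y" for y
    using g(2)[OF k_mem, of y] ip_sym[OF k_mem g(1), of y] reproducing[OF g(1), of y]
    by (simp add: mean_embedding_def k_sym[of y])
  then have "g = K \<nu>" by (rule ext)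
  with g show "K \<nu> \<in> H" "h \<in> H \<Longrightarrow> ip h (K \<nu>) = (\<integral>x. h x \<partial>\<nu>)" by auto
qed

lemma ip_mean_embedding_left: "\<nu> \<in> nonneg_measures \<Longrightarrow> h \<in> H \<Longrightarrow> ip (K \<nu>) h = (\<integral>x. h x \<partial>\<nu>)"
  by (simp add: ip_sym[OF mean_embedding_mem] ip_mean_embedding)

lemma continuous_mean_embedding: "\<nu> \<in> nonneg_measures \<Longrightarrow> continuous_on UNIV (K \<nu>)"
  by (intro continuous_mem mean_embedding_mem)

lemma continuous_kernel: "continuous_on UNIV (k x)" "continuous_on UNIV (\<lambda>x. k x y)"
  using continuous_mem[OF k_mem] by (simp_all add: k_sym[of _ y])

lemma mean_embedding_bounds:
  assumes \<nu>: "\<nu> \<in> nonneg_measures"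
  shows "K \<nu> y \<le> measure \<nu> UNIV" "(\<And>x y. m \<le> k x y) \<Longrightarrow> m * measure \<nu> UNIV \<le> K \<nu> y"
proof -
  have int: "integrable \<nu> (\<lambda>x. k x y)" "integrable \<nu> (\<lambda>x. c)" for c :: real
    by (intro continuous_integrable[OF cpt \<nu>] continuous_kernel continuous_on_const)+
  show "K \<nu> y \<le> measure \<nu> UNIV"
    using integral_mono[OF int(1) int(2)[of 1] k_le_1] by (simp add: mean_embedding_def measure_space_UNIV(3)[OF \<nu>])
  show "m * measure \<nu> UNIV \<le> K \<nu> y" if "\<And>x y. m \<le> k x y"
    using integral_mono[OF int(2) int(1) that] by (simp add: mean_embedding_def measure_space_UNIV(3)[OF \<nu>] mult.commute)
qed

lemma inj_on_mean_embedding: "inj_on K nonneg_measures"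
proof (rule inj_onI)
  fix \<mu> \<nu> :: "'a measure" assume \<mu>: "\<mu> \<in> nonneg_measures" and \<nu>: "\<nu> \<in> nonneg_measures" and eq: "K \<mu> = K \<nu>"
  have H_eq: "(\<integral>x. h x \<partial>\<mu>) = (\<integral>x. h x \<partial>\<nu>)" if "h \<in> H" for h
    using ip_mean_embedding[OF \<mu> that] ip_mean_embedding[OF \<nu> that] eq by simp
  show "\<mu> = \<nu>"
  proof (rule measure_eqI_continuous[OF cpt \<mu> \<nu>])
    fix f :: "'a \<Rightarrow> real" assume f: "continuous_on UNIV f"
    let ?D = "\<bar>(\<integral>x. f x \<partial>\<mu>) - (\<integral>x. f x \<partial>\<nu>)\<bar>" and ?S = "measure \<mu> UNIV + measure \<nu> UNIV"
    have bound: "?D \<le> \<eta> * ?S" if "\<eta> > 0" for \<eta>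
    proof -
      obtain h where h: "h \<in> H" "\<And>x. \<bar>f x - h x\<bar> \<le> \<eta>" using approximation[OF f \<open>\<eta> > 0\<close>] by blast
      have c: "continuous_on UNIV (\<lambda>x. f x - h x)" by (intro continuous_intros f continuous_mem h(1))
      have d: "(\<integral>x. f x - h x \<partial>\<alpha>) = (\<integral>x. f x \<partial>\<alpha>) - (\<integral>x. h x \<partial>\<alpha>)" if "\<alpha> \<in> nonneg_measures" for \<alpha>
        by (intro Bochner_Integration.integral_diff continuous_integrable[OF cpt that] f continuous_mem h(1))
      show ?thesis
        using abs_integral_le[OF cpt \<mu> c h(2)] abs_integral_le[OF cpt \<nu> c h(2)] H_eq[OF h(1)]
        unfolding d[OF \<mu>] d[OF \<nu>] distrib_left by linarith
    qed
    have "?S \<ge> 0" by simp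
    have "\<not> ?D > 0"
    proof
      assume D: "?D > 0"
      \<comment> \<open>This value of \<eta> makes the error bound at most half of
        \<open>?D\<close>; adding 1 to \<open>?S\<close> covers the case that both measures
        vanish.\<close>
      have "?D / (2 * (?S + 1)) * ?S < ?D" using D \<open>?S \<ge> 0\<close> by (simp add: field_simps add_strict_increasing)
      then show False using bound[of "?D / (2 * (?S + 1))"] D \<open>?S \<ge> 0\<close> by simp
    qed
    then show "(\<integral>x. f x \<partial>\<mu>) = (\<integral>x. f x \<partial>\<nu>)" by simp
  qed
qed

section \<open>Energy, mass and convergence on \<A>\<close>

lemma image_A_iff: "\<alpha> \<in> image_A k ip \<longleftrightarrow> \<alpha> \<in> nonneg_measures \<and> (\<integral>x. K \<alpha> x \<partial>\<alpha>) = 1"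
  by (auto simp: image_A_def ip_norm_def ip_mean_embedding mean_embedding_mem)

lemma image_B_eq: "image_B k ip = K ` image_A k ip"
  by (auto simp: image_B_def image_A_def)

lemma image_B_subset: "image_B k ip \<subseteq> H"
  by (auto simp: image_B_eq image_A_iff mean_embedding_mem)

text \<open>The energy \<integral> K \<alpha> d\<alpha> is the double integral of k, whose values
  lie between m and 1. With a the mass, m a^2 \<le> 1 \<le> a^2; the upper bound on a then uses a
  \<le> a^2.\<close>

lemma image_A_mass:
  assumes "\<alpha> \<in> image_A k ip" and m: "m > 0" "\<And>x y. m \<le> k x y"
  shows "1 \<le> measure \<alpha> UNIV" "measure \<alpha> UNIV \<le> 1 / m"
proof -
  have \<alpha>: "\<alpha> \<in> nonneg_measures" and one: "(\<integral>x. K \<alpha> x \<partial>\<alpha>) = 1" using assms(1) by (simp_all add: image_A_iff)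
  let ?a = "measure \<alpha> UNIV"
  have int: "integrable \<alpha> (K \<alpha>)" "integrable \<alpha> (\<lambda>x. c)" for c :: real
    by (intro continuous_integrable[OF cpt \<alpha>] continuous_mean_embedding[OF \<alpha>] continuous_on_const)+
  have "1 \<le> ?a * ?a"
    using integral_mono[OF int(1) int(2)[of ?a] mean_embedding_bounds(1)[OF \<alpha>]] by (simp add: one measure_space_UNIV(3)[OF \<alpha>])
  moreover have "?a * ?a \<le> ?a * 1" if "?a < 1" using that by (intro mult_left_mono) auto
  ultimately show 1: "1 \<le> ?a" by force
  have "m * ?a * ?a \<le> 1"
    using integral_mono[OF int(2)[of "m * ?a"] int(1) mean_embedding_bounds(2)[OF \<alpha> m(2)]] by (simp add: one measure_space_UNIV(3)[OF \<alpha>] mult_ac)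
  moreover have "m * ?a * 1 \<le> m * ?a * ?a" using 1 m(1) by (intro mult_left_mono) auto
  ultimately have "m * ?a \<le> 1" by linarith
  then show "?a \<le> 1 / m" using m(1) by (simp add: field_simps)
qed

text \<open>An Arzela-Ascoli argument: testing with the constant 1 bounds the masses eventually by
  \<open>S\<close>, so the functions \<open>K (\<alpha> n)\<close> inherit equicontinuity from k,
  and pointwise convergence on a finite \<delta>-net spreads to all points. Each of the two
  oscillations and the error on the net takes a third of \<eta>.\<close>

lemma uniform_convergence_mean_embedding:
  assumes \<alpha>: "\<And>n. \<alpha> n \<in> nonneg_measures" and \<nu>: "\<nu> \<in> nonneg_measures"
    and conv: "\<And>f :: 'a \<Rightarrow> real. continuous_on UNIV f \<Longrightarrow> (\<lambda>n. \<integral>x. f x \<partial>\<alpha> n) \<longlonglongrightarrow> (\<integral>x. f x \<partial>\<nu>)"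
    and "\<eta> > 0"
  shows "\<forall>\<^sub>F n in sequentially. \<forall>y. \<bar>K (\<alpha> n) y - K \<nu> y\<bar> \<le> \<eta>"
proof -
  define S where "S = measure \<nu> UNIV + 1"
  have S: "S > 0" "measure \<nu> UNIV \<le> S" unfolding S_def using measure_nonneg[of \<nu> UNIV] by linarith+
  have "(\<lambda>n. measure (\<alpha> n) UNIV) \<longlonglongrightarrow> measure \<nu> UNIV"
    using conv[OF continuous_on_const[of UNIV 1]] by (simp only: integral_const_UNIV[OF \<alpha>] integral_const_UNIV[OF \<nu>] mult_1)
  then have mass: "\<forall>\<^sub>F n in sequentially. measure (\<alpha> n) UNIV < S"
    by (rule order_tendstoD) (simp add: S_def)
  have "\<eta> / (3 * S) > 0" using S(1) \<open>\<eta> > 0\<close> by simp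
  then obtain \<delta> where d: "\<delta> > 0" "\<And>x y z. dist y z < \<delta> \<Longrightarrow> \<bar>k x y - k x z\<bar> \<le> \<eta> / (3 * S)"
    using kernel_equicontinuous by blast
  have osc: "\<bar>K \<mu> y - K \<mu> z\<bar> \<le> \<eta> / 3" if \<mu>: "\<mu> \<in> nonneg_measures" "measure \<mu> UNIV \<le> S" and yz: "dist y z < \<delta>" for \<mu> y z
  proof -
    have "K \<mu> y - K \<mu> z = (\<integral>x. k x y - k x z \<partial>\<mu>)"
      unfolding mean_embedding_def
      by (intro Bochner_Integration.integral_diff[symmetric] continuous_integrable[OF cpt \<mu>(1)] continuous_kernel)
    also have "\<bar>\<dots>\<bar> \<le> \<eta> / (3 * S) * measure \<mu> UNIV"
      by (intro abs_integral_le[OF cpt \<mu>(1)] continuous_intros continuous_kernel d(2)[OF yz])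
    also have "\<dots> \<le> \<eta> / (3 * S) * S" using S(1) \<open>\<eta> > 0\<close> \<mu>(2) by (intro mult_left_mono) auto
    finally show ?thesis using S(1) by simp
  qed
  obtain F where F: "finite F" "(UNIV :: 'a set) \<subseteq> (\<Union>z\<in>F. ball z \<delta>)"
    using cpt d(1) unfolding compact_eq_totally_bounded by blast
  have "\<forall>\<^sub>F n in sequentially. \<forall>z\<in>F. \<bar>K (\<alpha> n) z - K \<nu> z\<bar> < \<eta> / 3"
  proof (intro eventually_ball_finite F(1) ballI)
    fix z
    have "(\<lambda>n. K (\<alpha> n) z) \<longlonglongrightarrow> K \<nu> z" unfolding mean_embedding_def by (rule conv[OF continuous_kernel(2)])
    then show "\<forall>\<^sub>F n in sequentially. \<bar>K (\<alpha> n) z - K \<nu> z\<bar> < \<eta> / 3"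
      using tendstoD[of _ "K \<nu> z" sequentially "\<eta> / 3"] \<open>\<eta> > 0\<close> by (simp add: dist_real_def)
  qed
  with mass show ?thesis
  proof eventually_elim
    case (elim n)
    show ?case
    proof
      fix y
      have "y \<in> (\<Union>z\<in>F. ball z \<delta>)" using F(2) by blast
      then obtain z where z: "z \<in> F" "dist z y < \<delta>" by auto
      then have yz: "dist y z < \<delta>" by (simp add: dist_commute)
      show "\<bar>K (\<alpha> n) y - K \<nu> y\<bar> \<le> \<eta>"
        using osc[OF \<alpha> less_imp_le[OF elim(1)] yz] osc[OF \<nu> S(2) yz] bspec[OF elim(2) z(1)] by linarith
    qed
  qed
qed

text \<open>Expanding the squared distance, the cross term tests \<alpha> n against the fixed
  continuous function \<open>K \<nu>\<close>. In the energy of \<alpha> n both integrand and measure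
  move; uniform convergence together with bounded mass allows the integrand to be frozen at
  \<open>K \<nu>\<close>.\<close>

lemma weak_imp_norm_convergence:
  assumes \<alpha>: "\<And>n. \<alpha> n \<in> nonneg_measures" and \<nu>: "\<nu> \<in> nonneg_measures"
    and conv: "\<And>f :: 'a \<Rightarrow> real. continuous_on UNIV f \<Longrightarrow> (\<lambda>n. \<integral>x. f x \<partial>\<alpha> n) \<longlonglongrightarrow> (\<integral>x. f x \<partial>\<nu>)"
  shows "(\<lambda>n. \<integral>x. K (\<alpha> n) x \<partial>\<alpha> n) \<longlonglongrightarrow> (\<integral>x. K \<nu> x \<partial>\<nu>)"
    and "limitin M.mtopology (\<lambda>n. K (\<alpha> n)) (K \<nu>) sequentially"
proof -
  define S where "S = measure \<nu> UNIV + 1"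
  have S: "S > 0" unfolding S_def using measure_nonneg[of \<nu> UNIV] by linarith
  have "(\<lambda>n. measure (\<alpha> n) UNIV) \<longlonglongrightarrow> measure \<nu> UNIV"
    using conv[OF continuous_on_const[of UNIV 1]] by (simp only: integral_const_UNIV[OF \<alpha>] integral_const_UNIV[OF \<nu>] mult_1)
  then have mass: "\<forall>\<^sub>F n in sequentially. measure (\<alpha> n) UNIV < S"
    by (rule order_tendstoD) (simp add: S_def)
  have cross: "(\<lambda>n. \<integral>x. K \<nu> x \<partial>\<alpha> n) \<longlonglongrightarrow> (\<integral>x. K \<nu> x \<partial>\<nu>)" by (rule conv[OF continuous_mean_embedding[OF \<nu>]])
  have "(\<lambda>n. (\<integral>x. K (\<alpha> n) x \<partial>\<alpha> n) - (\<integral>x. K \<nu> x \<partial>\<alpha> n)) \<longlonglongrightarrow> 0"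
  proof (rule tendstoI)
    fix \<eta> :: real assume "\<eta> > 0"
    then have "\<eta> / (2 * S) > 0" using S by simp
    have "\<forall>\<^sub>F n in sequentially. \<forall>y. \<bar>K (\<alpha> n) y - K \<nu> y\<bar> \<le> \<eta> / (2 * S)"
      by (rule uniform_convergence_mean_embedding[OF \<alpha> \<nu> conv]) (assumption | fact)+
    with mass show "\<forall>\<^sub>F n in sequentially. dist ((\<integral>x. K (\<alpha> n) x \<partial>\<alpha> n) - (\<integral>x. K \<nu> x \<partial>\<alpha> n)) 0 < \<eta>"
    proof eventually_elim
      case (elim n)
      have "(\<integral>x. K (\<alpha> n) x \<partial>\<alpha> n) - (\<integral>x. K \<nu> x \<partial>\<alpha> n) = (\<integral>x. K (\<alpha> n) x - K \<nu> x \<partial>\<alpha> n)"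
        by (intro Bochner_Integration.integral_diff[symmetric] continuous_integrable[OF cpt \<alpha>] continuous_mean_embedding \<alpha> \<nu>)
      also have "\<bar>\<dots>\<bar> \<le> \<eta> / (2 * S) * measure (\<alpha> n) UNIV"
        by (intro abs_integral_le[OF cpt \<alpha>] continuous_intros continuous_mean_embedding \<alpha> \<nu>) (use elim(2) in blast)
      also have "\<dots> \<le> \<eta> / (2 * S) * S" using S \<open>\<eta> > 0\<close> elim(1) by (intro mult_left_mono) auto
      also have "\<dots> < \<eta>" using S \<open>\<eta> > 0\<close> by simp
      finally show ?case by simp
    qed
  qed
  from tendsto_add[OF this cross] show diag: "(\<lambda>n. \<integral>x. K (\<alpha> n) x \<partial>\<alpha> n) \<longlonglongrightarrow> (\<integral>x. K \<nu> x \<partial>\<nu>)" by simp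
  have "(\<lambda>n. (ip_dist H ip (K (\<alpha> n)) (K \<nu>))\<^sup>2) \<longlonglongrightarrow> (\<integral>x. K \<nu> x \<partial>\<nu>) - 2 * (\<integral>x. K \<nu> x \<partial>\<nu>) + (\<integral>x. K \<nu> x \<partial>\<nu>)"
    using mean_embedding_mem[OF \<alpha>] mean_embedding_mem[OF \<nu>]
    by (simp only: ip_dist_power2 ip_mean_embedding_left[OF \<alpha>] ip_mean_embedding_left[OF \<nu>])
       (intro tendsto_intros diag cross)
  then have "(\<lambda>n. sqrt ((ip_dist H ip (K (\<alpha> n)) (K \<nu>))\<^sup>2)) \<longlonglongrightarrow> sqrt 0" by (intro tendsto_real_sqrt) simp
  then show "limitin M.mtopology (\<lambda>n. K (\<alpha> n)) (K \<nu>) sequentially"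
    by (simp add: M.limitin_metric_dist_null mean_embedding_mem \<alpha> \<nu>)
qed

end

text \<open>If continuity fails at a, there are points s n of S within 1 / Suc n of a whose images
  avoid a fixed neighbourhood of F a.\<close>

lemma (in Metric_space) continuous_map_sequentiallyI:
  fixes F :: "'a \<Rightarrow> 'b::topological_space"
  assumes "S \<subseteq> M"
    and seq: "\<And>s l. (\<And>n. s n \<in> S) \<Longrightarrow> l \<in> S \<Longrightarrow> limitin mtopology s l sequentially \<Longrightarrow> (\<lambda>n. F (s n)) \<longlonglongrightarrow> F l"
  shows "continuous_map (subtopology mtopology S) euclidean F"
proof -
  interpret S: Submetric M d S by unfold_locales (rule assms(1))
  have "continuous_map S.sub.mtopology euclidean F"
    unfolding S.sub.continuous_map_from_metric
  proof (intro conjI ballI allI impI)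
    fix a U assume a: "a \<in> S" and U: "openin euclidean U \<and> F a \<in> U"
    show "\<exists>r>0. \<forall>x. x \<in> S \<and> d a x < r \<longrightarrow> F x \<in> U"
    proof (rule ccontr)
      assume neg: "\<not> ?thesis"
      have "\<exists>x. x \<in> S \<and> d a x < 1 / Suc n \<and> F x \<notin> U" for n
        using neg by (metis of_nat_0_less_iff zero_less_Suc zero_less_divide_1_iff)
      then obtain s where s: "\<And>n. s n \<in> S" "\<And>n. d a (s n) < 1 / Suc n" "\<And>n. F (s n) \<notin> U" by metis
      have "(\<lambda>n. d (s n) a) \<longlonglongrightarrow> 0"
        by (rule Lim_null_comparison[OF always_eventually LIMSEQ_inverse_real_of_nat])
           (use s(2) in \<open>auto simp: commute[of _ a] inverse_eq_divide intro: less_imp_le\<close>)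
      then have "limitin mtopology s a sequentially"
        using s(1) a assms(1) by (auto simp: limitin_metric_dist_null intro!: always_eventually)
      from seq[OF s(1) a this] have "\<forall>\<^sub>F n in sequentially. F (s n) \<in> U"
        using U by (intro topological_tendstoD) auto
      then show False using s(3) by (simp add: eventually_sequentially)
    qed
  qed simp
  then show ?thesis by (simp add: S.mtopology_submetric)
qed

section \<open>Total mass and continuous densities\<close>

lemma prob_measures_iff:
  "\<nu> \<in> prob_measures \<longleftrightarrow> \<nu> \<in> nonneg_measures \<and> measure \<nu> UNIV = 1"
proof
  assume "\<nu> \<in> nonneg_measures \<and> measure \<nu> UNIV = 1"
  then have \<nu>: "finite_measure \<nu>" "sets \<nu> = sets borel" "measure \<nu> UNIV = 1" by (auto simp: nonneg_measures_def)
  interpret finite_measure \<nu> by fact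
  have "prob_space \<nu>"
    by (rule prob_spaceI) (simp add: emeasure_eq_measure sets_eq_imp_space_eq[OF \<nu>(2)] \<nu>(3))
  then show "\<nu> \<in> prob_measures" using \<nu>(2) by (simp add: prob_measures_def)
next
  assume "\<nu> \<in> prob_measures"
  then have "prob_space \<nu>" and s: "sets \<nu> = sets borel" by (auto simp: prob_measures_def)
  then show "\<nu> \<in> nonneg_measures \<and> measure \<nu> UNIV = 1"
    using prob_space.finite_measure prob_space.prob_space[of \<nu>] sets_eq_imp_space_eq[OF s]
    by (auto simp: nonneg_measures_def)
qed

lemma continuous_density:
  fixes w f :: "'a::metric_space \<Rightarrow> real"
  assumes cpt: "compact (UNIV :: 'a set)" and \<nu>: "\<nu> \<in> nonneg_measures"
    and w: "continuous_on UNIV w" "\<And>x. 0 \<le> w x"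
  shows density_mem: "density \<nu> (\<lambda>x. ennreal (w x)) \<in> nonneg_measures"
    and integral_density_continuous: "continuous_on UNIV f \<Longrightarrow>
      (\<integral>x. f x \<partial>density \<nu> (\<lambda>x. ennreal (w x))) = (\<integral>x. w x * f x \<partial>\<nu>)"
proof -
  have s: "sets \<nu> = sets borel" using \<nu> by (simp add: nonneg_measures_def)
  have m: "f \<in> borel_measurable \<nu>" if "continuous_on UNIV f" for f :: "'a \<Rightarrow> real"
    unfolding measurable_cong_sets[OF s refl] by (rule borel_measurable_continuous_onI[OF that])
  have wm: "(\<lambda>x. ennreal (w x)) \<in> borel_measurable \<nu>" by (rule measurable_compose[OF m[OF w(1)]]) simp
  have "emeasure (density \<nu> (\<lambda>x. ennreal (w x))) (space \<nu>) = (\<integral>\<^sup>+x. ennreal (w x) \<partial>\<nu>)"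
    by (subst emeasure_density[OF wm]) (auto intro!: nn_integral_cong)
  also have "\<dots> = ennreal (\<integral>x. w x \<partial>\<nu>)"
    by (rule nn_integral_eq_integral[OF continuous_integrable[OF cpt \<nu> w(1)]]) (simp add: w(2))
  finally have "finite_measure (density \<nu> (\<lambda>x. ennreal (w x)))" by (intro finite_measureI) simp
  then show "density \<nu> (\<lambda>x. ennreal (w x)) \<in> nonneg_measures" by (simp add: nonneg_measures_def s)
  show "(\<integral>x. f x \<partial>density \<nu> (\<lambda>x. ennreal (w x))) = (\<integral>x. w x * f x \<partial>\<nu>)" if "continuous_on UNIV f"
    by (subst integral_density[OF m[OF that] m[OF w(1)]]) (simp_all add: w(2))
qed

section \<open>Compactness of \<B> and the marginal of k \<alpha> \<otimes> \<alpha>\<close>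

context positive_kernel_rkhs begin

lemma integral_one: "\<nu> \<in> nonneg_measures \<Longrightarrow> (\<integral>x. 1 \<partial>\<nu>) = measure \<nu> UNIV"
  using integral_const_UNIV[of \<nu> 1] by simp

text \<open>The masses stay in [1, 1 / m], so one may divide by them, extract a limit of the
  resulting probabilities, extract again to make the masses converge to some \<open>L\<close>, and
  multiply back by \<open>L\<close>.\<close>

lemma image_A_sequentially_compact:
  assumes \<alpha>: "\<And>n. \<alpha> n \<in> image_A k ip"
  obtains r \<nu> where "strict_mono (r :: nat \<Rightarrow> nat)" "\<nu> \<in> nonneg_measures"
    "\<And>f :: 'a \<Rightarrow> real. continuous_on UNIV f \<Longrightarrow> (\<lambda>n. \<integral>x. f x \<partial>\<alpha> (r n)) \<longlonglongrightarrow> (\<integral>x. f x \<partial>\<nu>)"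
proof -
  obtain m where m: "m > 0" "\<And>x y. m \<le> k x y" using kernel_lower_bound by blast
  define a where "a n = measure (\<alpha> n) UNIV" for n
  have a: "1 \<le> a n" "a n \<le> 1 / m" for n using image_A_mass[OF \<alpha> m] by (simp_all add: a_def)
  have \<alpha>': "\<alpha> n \<in> nonneg_measures" for n using \<alpha> by (simp add: image_A_iff)
  define q where "q n = density (\<alpha> n) (\<lambda>x. ennreal (1 / a n))" for n
  have a0: "0 \<le> 1 / a n" for n using a(1)[of n] by simp
  have int_q: "(\<integral>x. f x \<partial>q n) = 1 / a n * (\<integral>x. f x \<partial>\<alpha> n)" if "continuous_on UNIV f" for f :: "'a \<Rightarrow> real" and n
    using integral_density_continuous[OF cpt \<alpha>' continuous_on_const a0 that, of n n] by (simp add: q_def)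
  have q_mem: "q n \<in> nonneg_measures" for n unfolding q_def by (rule density_mem[OF cpt \<alpha>' continuous_on_const a0])
  have "(\<integral>x. 1 \<partial>q n) = 1 / a n * a n" for n
    unfolding int_q[OF continuous_on_const] integral_one[OF \<alpha>'] a_def ..
  then have "measure (q n) UNIV = 1" for n using integral_one[OF q_mem, of n] a(1)[of n] by simp
  then have "q n \<in> prob_measures" for n using q_mem by (simp add: prob_measures_iff)
  then obtain r1 p where r1: "strict_mono r1" and p: "p \<in> prob_measures"
    and conv: "\<And>f :: 'a \<Rightarrow> real. continuous_on UNIV f \<Longrightarrow> (\<lambda>n. \<integral>x. f x \<partial>q (r1 n)) \<longlonglongrightarrow> (\<integral>x. f x \<partial>p)"
    by (rule prob_measures_sequentially_compact[OF cpt]) (rule that)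
  have "seq_compact {1..1 / m}" by (simp add: compact_imp_seq_compact)
  moreover have "\<forall>n. (a \<circ> r1) n \<in> {1..1 / m}" using a by simp
  ultimately obtain L r2 where L: "L \<in> {1..1 / m}" and r2: "strict_mono r2" and aL: "((a \<circ> r1) \<circ> r2) \<longlonglongrightarrow> L"
    unfolding seq_compact_def by blast
  have p': "p \<in> nonneg_measures" using p prob_subset_nonneg by blast
  have L0: "0 \<le> L" using L by simp
  show thesis
  proof (rule that)
    show "strict_mono (r1 \<circ> r2)" by (rule strict_mono_o[OF r1 r2])
    show "density p (\<lambda>x. ennreal L) \<in> nonneg_measures" by (rule density_mem[OF cpt p' continuous_on_const L0])
    fix f :: "'a \<Rightarrow> real" assume f: "continuous_on UNIV f"
    have "(\<lambda>n. a (r1 (r2 n)) * (\<integral>x. f x \<partial>q (r1 (r2 n)))) \<longlonglongrightarrow> L * (\<integral>x. f x \<partial>p)"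
      using tendsto_mult[OF aL LIMSEQ_subseq_LIMSEQ[OF conv[OF f] r2]] by (simp add: comp_def)
    moreover have "a n * (\<integral>x. f x \<partial>q n) = (\<integral>x. f x \<partial>\<alpha> n)" for n using a(1)[of n] by (simp add: int_q[OF f])
    moreover have "(\<integral>x. f x \<partial>density p (\<lambda>x. ennreal L)) = L * (\<integral>x. f x \<partial>p)"
      using integral_density_continuous[OF cpt p' continuous_on_const L0 f] by simp
    ultimately show "(\<lambda>n. \<integral>x. f x \<partial>\<alpha> ((r1 \<circ> r2) n)) \<longlonglongrightarrow> (\<integral>x. f x \<partial>density p (\<lambda>x. ennreal L))" by simp
  qed
qed

theorem compactin_norm_image_B: "compactin M.mtopology (image_B k ip)"
  unfolding M.compactin_sequentially
proof (intro conjI allI impI)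
  show "image_B k ip \<subseteq> H" by (rule image_B_subset)
  fix \<sigma> :: "nat \<Rightarrow> 'a \<Rightarrow> real" assume "range \<sigma> \<subseteq> image_B k ip"
  then have "\<forall>n. \<exists>\<alpha>\<in>image_A k ip. \<sigma> n = K \<alpha>" unfolding image_B_eq by blast
  then obtain \<alpha> where \<alpha>: "\<And>n. \<alpha> n \<in> image_A k ip" "\<And>n. \<sigma> n = K (\<alpha> n)" by metis
  obtain r \<nu> where r: "strict_mono (r :: nat \<Rightarrow> nat)" and \<nu>: "\<nu> \<in> nonneg_measures"
    and conv: "\<And>f :: 'a \<Rightarrow> real. continuous_on UNIV f \<Longrightarrow> (\<lambda>n. \<integral>x. f x \<partial>\<alpha> (r n)) \<longlonglongrightarrow> (\<integral>x. f x \<partial>\<nu>)"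
    by (rule image_A_sequentially_compact[of \<alpha>, OF \<alpha>(1)]) (rule that)
  have \<alpha>r: "\<alpha> (r n) \<in> nonneg_measures" "(\<integral>x. K (\<alpha> (r n)) x \<partial>\<alpha> (r n)) = 1" for n
    using \<alpha>(1) by (simp_all add: image_A_iff)
  note lim = weak_imp_norm_convergence[of "\<lambda>n. \<alpha> (r n)", OF \<alpha>r(1) \<nu> conv]
  \<comment> \<open>The energies are constantly 1 and converge to the energy of \<nu>; this is where
    the limit is seen to lie in \<A> again.\<close>
  have "(\<lambda>n::nat. 1) \<longlonglongrightarrow> (\<integral>x. K \<nu> x \<partial>\<nu>)" using lim(1) by (simp add: \<alpha>r(2))
  then have "\<nu> \<in> image_A k ip" using \<nu> by (simp add: image_A_iff LIMSEQ_const_iff)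
  moreover have "limitin M.mtopology (\<sigma> \<circ> r) (K \<nu>) sequentially" using lim(2) by (simp add: comp_def \<alpha>(2))
  ultimately show "\<exists>l r. l \<in> image_B k ip \<and> strict_mono r \<and> limitin M.mtopology (\<sigma> \<circ> r) l sequentially"
    using r unfolding image_B_eq by blast
qed

text \<open>Norm convergence of the embeddings tests the measures against elements of H only. The
  common mass bound on \<A> extends this to all continuous functions by uniform
  approximation.\<close>

lemma norm_imp_weak_convergence:
  assumes \<alpha>: "\<And>n. \<alpha> n \<in> image_A k ip" and \<nu>: "\<nu> \<in> image_A k ip"
    and lim: "limitin M.mtopology (\<lambda>n. K (\<alpha> n)) (K \<nu>) sequentially"
    and f: "continuous_on UNIV (f :: 'a \<Rightarrow> real)"
  shows "(\<lambda>n. \<integral>x. f x \<partial>\<alpha> n) \<longlonglongrightarrow> (\<integral>x. f x \<partial>\<nu>)"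
proof (rule tendstoI)
  fix \<eta> :: real assume "\<eta> > 0"
  obtain m where m: "m > 0" "\<And>x y. m \<le> k x y" using kernel_lower_bound by blast
  \<comment> \<open>The factor m cancels the mass bound 1 / m, so replacing f by h costs \<eta> / 4
    for each of the two measures.\<close>
  have "\<eta> * m / 4 > 0" using \<open>\<eta> > 0\<close> m by simp
  then obtain h where h: "h \<in> H" "\<And>x. \<bar>f x - h x\<bar> \<le> \<eta> * m / 4" using approximation[OF f] by blast
  have close: "\<bar>(\<integral>x. f x \<partial>\<mu>) - (\<integral>x. h x \<partial>\<mu>)\<bar> \<le> \<eta> / 4" if \<mu>: "\<mu> \<in> image_A k ip" for \<mu>
  proof -
    have \<mu>': "\<mu> \<in> nonneg_measures" using \<mu> by (simp add: image_A_iff)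
    have "(\<integral>x. f x \<partial>\<mu>) - (\<integral>x. h x \<partial>\<mu>) = (\<integral>x. f x - h x \<partial>\<mu>)"
      by (intro Bochner_Integration.integral_diff[symmetric] continuous_integrable[OF cpt \<mu>'] f continuous_mem h(1))
    also have "\<bar>\<dots>\<bar> \<le> \<eta> * m / 4 * measure \<mu> UNIV"
      by (intro abs_integral_le[OF cpt \<mu>'] continuous_intros f continuous_mem h)
    also have "\<dots> \<le> \<eta> * m / 4 * (1 / m)"
      using image_A_mass(2)[OF \<mu> m] \<open>\<eta> > 0\<close> m(1) by (intro mult_left_mono) auto
    finally show ?thesis using m(1) by simp
  qed
  have n: "\<alpha> n \<in> nonneg_measures" "\<nu> \<in> nonneg_measures" for n using \<alpha> \<nu> by (simp_all add: image_A_iff)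
  have "(\<lambda>n. \<integral>x. h x \<partial>\<alpha> n) \<longlonglongrightarrow> (\<integral>x. h x \<partial>\<nu>)"
    using tendsto_ip[OF lim mean_embedding_mem[OF n(1)] h(1)] by (simp add: ip_mean_embedding_left n h(1))
  then have "\<forall>\<^sub>F n in sequentially. dist (\<integral>x. h x \<partial>\<alpha> n) (\<integral>x. h x \<partial>\<nu>) < \<eta> / 4"
    by (rule tendstoD) (use \<open>\<eta> > 0\<close> in simp)
  then show "\<forall>\<^sub>F n in sequentially. dist (\<integral>x. f x \<partial>\<alpha> n) (\<integral>x. f x \<partial>\<nu>) < \<eta>"
  proof eventually_elim
    case (elim n)
    then show ?case using close[OF \<alpha>, of n] close[OF \<nu>] \<open>\<eta> > 0\<close> unfolding dist_real_def by linarith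
  qed
qed

text \<open>Tonelli: integrating out the second variable leaves the density \<integral> k x y
  d\<alpha>(y), which is \<open>K \<alpha> x\<close> by symmetry of k. From here on the inverse of A
  is the map from \<alpha> to (K \<alpha>) \<alpha>.\<close>

lemma kernel_marginal_eq_density:
  assumes \<alpha>: "\<alpha> \<in> nonneg_measures"
  shows "kernel_marginal k \<alpha> = density \<alpha> (\<lambda>x. ennreal (K \<alpha> x))"
proof (rule measure_eqI)
  interpret finite_measure \<alpha> by (rule measure_space_UNIV[OF \<alpha>])
  note s = measure_space_UNIV(2,3)[OF \<alpha>]
  have sp: "sets (\<alpha> \<Otimes>\<^sub>M \<alpha>) = sets (borel \<Otimes>\<^sub>M borel)" by (rule sets_pair_measure_cong[OF s(1) s(1)])
  have km: "(\<lambda>(x, y). k x y) \<in> borel_measurable (\<alpha> \<Otimes>\<^sub>M \<alpha>)"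
    unfolding measurable_cong_sets[OF sp refl] by (rule continuous_measurable_pair[OF cpt k_cont])
  then have em: "(\<lambda>(x, y). ennreal (k x y)) \<in> borel_measurable (\<alpha> \<Otimes>\<^sub>M \<alpha>)"
    using measurable_compose[OF km measurable_ennreal] by (simp add: case_prod_beta)
  have fstm: "fst \<in> \<alpha> \<Otimes>\<^sub>M \<alpha> \<rightarrow>\<^sub>M borel"
    using measurable_fst[of \<alpha> \<alpha>] measurable_cong_sets[OF refl s(1), of "\<alpha> \<Otimes>\<^sub>M \<alpha>"] by simp
  show "sets (kernel_marginal k \<alpha>) = sets (density \<alpha> (\<lambda>x. ennreal (K \<alpha> x)))"
    by (simp add: kernel_marginal_def s)
  fix E assume "E \<in> sets (kernel_marginal k \<alpha>)"
  then have E: "E \<in> sets borel" "E \<in> sets \<alpha>" by (simp_all add: kernel_marginal_def s)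
  have pre: "fst -` E \<inter> space (\<alpha> \<Otimes>\<^sub>M \<alpha>) \<in> sets (\<alpha> \<Otimes>\<^sub>M \<alpha>)" by (rule measurable_sets[OF fstm E(1)])
  have Km: "(\<lambda>x. ennreal (K \<alpha> x)) \<in> borel_measurable \<alpha>"
    unfolding measurable_cong_sets[OF s(1) refl]
    by (intro measurable_compose[OF borel_measurable_continuous_onI[OF continuous_mean_embedding[OF \<alpha>]]] measurable_ennreal)
  have inner: "(\<integral>\<^sup>+y. ennreal (k x y) \<partial>\<alpha>) = ennreal (K \<alpha> x)" for x
    by (subst nn_integral_eq_integral[OF continuous_integrable[OF cpt \<alpha> continuous_kernel(1)]])
       (simp_all add: less_imp_le[OF k_pos] mean_embedding_def k_sym[of _ x])
  have "emeasure (kernel_marginal k \<alpha>) E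
      = emeasure (density (\<alpha> \<Otimes>\<^sub>M \<alpha>) (\<lambda>(x, y). ennreal (k x y))) (fst -` E \<inter> space (\<alpha> \<Otimes>\<^sub>M \<alpha>))"
    unfolding kernel_marginal_def by (subst emeasure_distr) (use fstm E in \<open>simp_all add: measurable_density_eq1\<close>)
  also have "\<dots> = (\<integral>\<^sup>+z. ennreal (k (fst z) (snd z)) * indicator E (fst z) \<partial>(\<alpha> \<Otimes>\<^sub>M \<alpha>))"
    by (subst emeasure_density[OF em pre]) (auto intro!: nn_integral_cong simp: indicator_def)
  also have "\<dots> = (\<integral>\<^sup>+x. \<integral>\<^sup>+y. ennreal (k x y) * indicator E x \<partial>\<alpha> \<partial>\<alpha>)"
  proof (subst nn_integral_fst[symmetric])
    show "(\<lambda>z. ennreal (k (fst z) (snd z)) * indicator E (fst z)) \<in> borel_measurable (\<alpha> \<Otimes>\<^sub>M \<alpha>)"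
      using em fstm E(1) by (intro borel_measurable_times_ennreal measurable_compose[OF fstm]) (simp_all add: case_prod_beta)
  qed simp
  also have "\<dots> = (\<integral>\<^sup>+x. ennreal (K \<alpha> x) * indicator E x \<partial>\<alpha>)"
  proof (rule nn_integral_cong)
    fix x
    have "(\<lambda>y. ennreal (k x y)) \<in> borel_measurable \<alpha>"
      unfolding measurable_cong_sets[OF s(1) refl]
      by (intro measurable_compose[OF borel_measurable_continuous_onI[OF continuous_kernel(1)]] measurable_ennreal)
    then show "(\<integral>\<^sup>+y. ennreal (k x y) * indicator E x \<partial>\<alpha>) = ennreal (K \<alpha> x) * indicator E x"
      by (simp add: nn_integral_multc inner)
  qed
  also have "\<dots> = emeasure (density \<alpha> (\<lambda>x. ennreal (K \<alpha> x))) E" by (rule emeasure_density[OF Km E(2), symmetric])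
  finally show "emeasure (kernel_marginal k \<alpha>) E = emeasure (density \<alpha> (\<lambda>x. ennreal (K \<alpha> x))) E" .
qed

lemma mean_embedding_nonneg: "0 \<le> K \<nu> x"
  unfolding mean_embedding_def by (intro Bochner_Integration.integral_nonneg less_imp_le[OF k_pos])

text \<open>The total mass of the marginal is the energy of \<alpha>, so the norm constraint that
  defines \<A> is exactly the normalisation to a probability.\<close>

lemma kernel_marginal_mem:
  assumes \<alpha>: "\<alpha> \<in> image_A k ip"
  shows "kernel_marginal k \<alpha> \<in> prob_measures"
proof -
  have n: "\<alpha> \<in> nonneg_measures" "(\<integral>x. K \<alpha> x \<partial>\<alpha>) = 1" using \<alpha> by (simp_all add: image_A_iff)
  note c = continuous_mean_embedding[OF n(1)]
  have d: "kernel_marginal k \<alpha> \<in> nonneg_measures"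
    unfolding kernel_marginal_eq_density[OF n(1)] by (rule density_mem[OF cpt n(1) c mean_embedding_nonneg])
  have "measure (kernel_marginal k \<alpha>) UNIV = (\<integral>x. 1 \<partial>kernel_marginal k \<alpha>)" by (rule integral_one[OF d, symmetric])
  also have "\<dots> = 1"
    unfolding kernel_marginal_eq_density[OF n(1)]
    by (subst integral_density_continuous[OF cpt n(1) c mean_embedding_nonneg continuous_on_const]) (simp add: n(2))
  finally show ?thesis using d by (simp add: prob_measures_iff)
qed

lemma integral_kernel_marginal:
  assumes "\<alpha> \<in> nonneg_measures" "continuous_on UNIV (f :: 'a \<Rightarrow> real)"
  shows "(\<integral>x. f x \<partial>kernel_marginal k \<alpha>) = (\<integral>x. K \<alpha> x * f x \<partial>\<alpha>)"
  unfolding kernel_marginal_eq_density[OF assms(1)]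
  by (rule integral_density_continuous[OF cpt assms(1) continuous_mean_embedding[OF assms(1)] mean_embedding_nonneg assms(2)])

text \<open>Density and measure vary together. The density is frozen first, at a cost bounded by the
  norm distance of the embeddings times the mass bound; what remains is the fixed continuous test
  function \<open>K \<nu>\<close> times f.\<close>

lemma norm_imp_weak_convergence_marginal:
  assumes \<alpha>: "\<And>n. \<alpha> n \<in> image_A k ip" and \<nu>: "\<nu> \<in> image_A k ip"
    and lim: "limitin M.mtopology (\<lambda>n. K (\<alpha> n)) (K \<nu>) sequentially"
    and f: "continuous_on UNIV (f :: 'a \<Rightarrow> real)"
  shows "(\<lambda>n. \<integral>x. f x \<partial>kernel_marginal k (\<alpha> n)) \<longlonglongrightarrow> (\<integral>x. f x \<partial>kernel_marginal k \<nu>)"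
proof -
  have n: "\<alpha> n \<in> nonneg_measures" "\<nu> \<in> nonneg_measures" for n using \<alpha> \<nu> by (simp_all add: image_A_iff)
  obtain m where m: "m > 0" "\<And>x y. m \<le> k x y" using kernel_lower_bound by blast
  obtain B where B: "B \<ge> 0" "\<And>x. \<bar>f x\<bar> \<le> B" using continuous_bounded_on_compact_type[OF cpt f] by blast
  note c = continuous_mean_embedding[OF n(1)] continuous_mean_embedding[OF n(2)]
  let ?d = "\<lambda>n. ip_dist H ip (K (\<alpha> n)) (K \<nu>)"
  have d0: "?d \<longlonglongrightarrow> 0" using lim by (simp add: M.limitin_metric_dist_null)
  have main: "(\<lambda>n. \<integral>x. K \<nu> x * f x \<partial>\<alpha> n) \<longlonglongrightarrow> (\<integral>x. K \<nu> x * f x \<partial>\<nu>)"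
    by (rule norm_imp_weak_convergence[OF \<alpha> \<nu> lim]) (intro continuous_intros c f)
  have "(\<lambda>n. (\<integral>x. K (\<alpha> n) x * f x \<partial>\<alpha> n) - (\<integral>x. K \<nu> x * f x \<partial>\<alpha> n)) \<longlonglongrightarrow> 0"
  proof (rule Lim_null_comparison[OF always_eventually tendsto_mult_left_zero[OF d0, of "B * (1 / m)"]], rule allI)
    fix i
    have "(\<integral>x. K (\<alpha> i) x * f x \<partial>\<alpha> i) - (\<integral>x. K \<nu> x * f x \<partial>\<alpha> i) = (\<integral>x. K (\<alpha> i) x * f x - K \<nu> x * f x \<partial>\<alpha> i)"
      by (intro Bochner_Integration.integral_diff[symmetric] continuous_integrable[OF cpt n(1)] continuous_intros c f)
    also have "\<bar>\<dots>\<bar> \<le> (?d i * B) * measure (\<alpha> i) UNIV"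
    proof (intro abs_integral_le[OF cpt n(1)] continuous_intros c f)
      fix x
      have mem: "K (\<alpha> i) \<in> H" "K \<nu> \<in> H" by (rule mean_embedding_mem[OF n(1)], rule mean_embedding_mem[OF n(2)])
      have "\<bar>K (\<alpha> i) x - K \<nu> x\<bar> \<le> ?d i" using abs_le_ip_norm[OF diff_mem[OF mem], of x] by (simp add: ip_dist_eq mem)
      then have "\<bar>K (\<alpha> i) x - K \<nu> x\<bar> * \<bar>f x\<bar> \<le> ?d i * B" by (intro mult_mono B) auto
      then show "\<bar>K (\<alpha> i) x * f x - K \<nu> x * f x\<bar> \<le> ?d i * B" by (simp add: abs_mult left_diff_distrib[symmetric])
    qed
    also have "\<dots> \<le> (?d i * B) * (1 / m)" using image_A_mass(2)[OF \<alpha> m] B(1) by (intro mult_left_mono) auto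
    finally show "norm ((\<integral>x. K (\<alpha> i) x * f x \<partial>\<alpha> i) - (\<integral>x. K \<nu> x * f x \<partial>\<alpha> i)) \<le> ?d i * (B * (1 / m))"
      by (simp add: mult.assoc)
  qed
  from tendsto_add[OF this main] show ?thesis
    by (simp add: integral_kernel_marginal[OF n(1) f] integral_kernel_marginal[OF n(2) f])
qed

end

section \<open>Existence and uniqueness of the potential\<close>

lemma measurable_continuous_nonneg_measures:
  fixes f :: "'a::metric_space \<Rightarrow> real"
  assumes "\<nu> \<in> nonneg_measures" "continuous_on UNIV f"
  shows "f \<in> borel_measurable \<nu>"
proof -
  have s: "sets \<nu> = sets borel" using assms(1) by (simp add: nonneg_measures_def)
  show ?thesis unfolding measurable_cong_sets[OF s refl] by (rule borel_measurable_continuous_onI[OF assms(2)])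
qed

text \<open>
  Up to a constant factor, the sum of \<open>\<alpha>\<close> and a point mass at \<open>z\<close> is the law of a point chosen by
  a coin that decides between \<open>z\<close> and a draw from \<open>\<alpha>\<close>.
\<close>

lemma add_point_mass:
  fixes \<alpha> :: "'a::metric_space measure"
  assumes cpt: "compact (UNIV :: 'a set)" and \<alpha>: "\<alpha> \<in> nonneg_measures"
    and mass: "measure \<alpha> UNIV > 0" and t: "t \<ge> 0" and c: "c \<ge> 0"
  obtains \<gamma> where "\<gamma> \<in> nonneg_measures"
    "\<And>f :: 'a \<Rightarrow> real. continuous_on UNIV f \<Longrightarrow> (\<integral>x. f x \<partial>\<gamma>) = c * ((\<integral>x. f x \<partial>\<alpha>) + t * f z)"
proof -
  define a where "a = measure \<alpha> UNIV"
  have a: "a > 0" using mass by (simp add: a_def)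
  \<comment> \<open>This probability and the weight \<open>w\<close> below solve w * (s * a) = c * t
    and w * (1 - s) = c.\<close>
  define s where "s = t / (a + t)"
  have s: "s \<in> {0..1}" using a t by (simp add: s_def)
  interpret \<alpha>: finite_measure \<alpha> using \<alpha> by (simp add: nonneg_measures_def)
  have sets[measurable_cong]: "sets \<alpha> = sets borel" using \<alpha> by (simp add: nonneg_measures_def)
  have sp: "space \<alpha> = UNIV" using sets_eq_imp_space_eq[OF sets] by simp
  let ?B = "measure_pmf (bernoulli_pmf s)"
  let ?h = "\<lambda>(x, b). if b then z else x"
  have h[measurable]: "?h \<in> \<alpha> \<Otimes>\<^sub>M ?B \<rightarrow>\<^sub>M borel" by measurable
  interpret P: pair_sigma_finite \<alpha> ?B ..
  have finP: "finite_measure (\<alpha> \<Otimes>\<^sub>M ?B)"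
    by (rule finite_measure_pair_measure[OF measure_pmf.finite_measure_axioms \<alpha>.finite_measure_axioms])
  define \<gamma>0 where "\<gamma>0 = distr (\<alpha> \<Otimes>\<^sub>M ?B) borel ?h"
  have \<gamma>0: "\<gamma>0 \<in> nonneg_measures"
    unfolding \<gamma>0_def nonneg_measures_def using finite_measure.finite_measure_distr[OF finP h] by simp
  have int0: "(\<integral>x. f x \<partial>\<gamma>0) = s * a * f z + (1 - s) * (\<integral>x. f x \<partial>\<alpha>)" if f: "continuous_on UNIV f" for f :: "'a \<Rightarrow> real"
  proof -
    have fm[measurable]: "f \<in> borel_measurable borel" by (rule borel_measurable_continuous_onI[OF f])
    obtain b where b: "\<And>x. \<bar>f x\<bar> \<le> b" using continuous_bounded_on_compact_type[OF cpt f] by blast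
    have fhm: "(\<lambda>w. f (?h w)) \<in> borel_measurable (\<alpha> \<Otimes>\<^sub>M ?B)" by (rule measurable_compose[OF h fm])
    have int: "integrable (\<alpha> \<Otimes>\<^sub>M ?B) (\<lambda>w. f (?h w))"
      by (rule finite_measure.integrable_const_bound[OF finP _ fhm, of b]) (simp add: b)
    have "(\<integral>x. f x \<partial>\<gamma>0) = (\<integral>w. f (?h w) \<partial>(\<alpha> \<Otimes>\<^sub>M ?B))"
      unfolding \<gamma>0_def by (rule integral_distr[OF h fm])
    also have "\<dots> = (\<integral>x. (\<integral>b. f (?h (x, b)) \<partial>?B) \<partial>\<alpha>)" by (rule P.integral_fst'[OF int, symmetric])
    also have "\<dots> = (\<integral>x. s * f z + (1 - s) * f x \<partial>\<alpha>)" using s by (simp add: mult.commute)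
    also have "\<dots> = s * a * f z + (1 - s) * (\<integral>x. f x \<partial>\<alpha>)"
      using continuous_integrable[OF cpt \<alpha> f] by (simp add: sp a_def)
    finally show ?thesis .
  qed
  define w where "w = c * (a + t) / a"
  have w: "w \<ge> 0" using a t c by (simp add: w_def)
  show thesis
  proof (rule that)
    show "density \<gamma>0 (\<lambda>x. ennreal w) \<in> nonneg_measures" by (rule density_mem[OF cpt \<gamma>0 continuous_on_const w])
    fix f :: "'a \<Rightarrow> real" assume f: "continuous_on UNIV f"
    have nz: "a \<noteq> 0" "a + t \<noteq> 0" using a t by auto
    then have "1 - s = a / (a + t)" by (simp add: s_def diff_divide_eq_iff)
    then have ws: "w * (s * a) = c * t" "w * (1 - s) = c" using nz by (simp_all add: w_def s_def)
    have "(\<integral>x. f x \<partial>density \<gamma>0 (\<lambda>x. ennreal w)) = w * (\<integral>x. f x \<partial>\<gamma>0)"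
      using integral_density_continuous[OF cpt \<gamma>0 continuous_on_const w f] by simp
    also have "\<dots> = (w * (s * a)) * f z + (w * (1 - s)) * (\<integral>x. f x \<partial>\<alpha>)" by (simp add: int0[OF f] algebra_simps)
    also have "\<dots> = c * ((\<integral>x. f x \<partial>\<alpha>) + t * f z)" unfolding ws by (simp add: algebra_simps)
    finally show "(\<integral>x. f x \<partial>density \<gamma>0 (\<lambda>x. ennreal w)) = c * ((\<integral>x. f x \<partial>\<alpha>) + t * f z)" .
  qed
qed

text \<open>
  In terms of the potential, \<open>g = exp (- f / \<epsilon>)\<close>.
\<close>

definition self_scaling :: "('a::metric_space \<Rightarrow> 'a \<Rightarrow> real) \<Rightarrow> 'a measure \<Rightarrow> ('a \<Rightarrow> real) \<Rightarrow> bool" where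
  "self_scaling k \<mu> g \<longleftrightarrow>
     continuous_on UNIV g \<and> (\<forall>x. 0 < g x) \<and> (\<forall>y. (\<integral>x. k x y / g x \<partial>\<mu>) = g y)"

context positive_kernel_rkhs begin

section \<open>Scalings of \<mu> correspond to elements of \<A> with marginal \<mu>\<close>

lemma continuous_inverse_weight:
  assumes "continuous_on UNIV g" "\<And>x. 0 < (g x :: real)"
  shows "continuous_on UNIV (\<lambda>x :: 'a. 1 / g x)" "\<And>x. 0 \<le> 1 / g x"
proof -
  have "g x \<noteq> 0" for x using assms(2)[of x] by simp
  then show "continuous_on UNIV (\<lambda>x :: 'a. 1 / g x)" by (intro continuous_intros assms(1)) simp
  show "0 \<le> 1 / g x" for x using assms(2)[of x] by simp
qed

lemma mean_embedding_density:
  assumes "\<mu> \<in> nonneg_measures" "continuous_on UNIV g" "\<And>x. 0 < g x"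
  shows "K (density \<mu> (\<lambda>x. ennreal (1 / g x))) y = (\<integral>x. k x y / g x \<partial>\<mu>)"
  unfolding mean_embedding_def
  by (subst integral_density_continuous[OF cpt assms(1) continuous_inverse_weight[OF assms(2,3)] continuous_kernel(2)]) simp

text \<open>For \<alpha> = \<mu> / g the scaling equation says K \<alpha> = g. Then the energy is
  \<integral> g / g d\<mu> = 1, and (K \<alpha>) \<alpha> = g \<mu> / g = \<mu>.\<close>

lemma self_scaling_density:
  assumes \<mu>: "\<mu> \<in> prob_measures" and g: "self_scaling k \<mu> g"
  shows "K (density \<mu> (\<lambda>x. ennreal (1 / g x))) = g"
    and "density \<mu> (\<lambda>x. ennreal (1 / g x)) \<in> image_A k ip"
    and "kernel_marginal k (density \<mu> (\<lambda>x. ennreal (1 / g x))) = \<mu>"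
proof -
  have gc: "continuous_on UNIV g" "\<And>x. 0 < g x" using g by (simp_all add: self_scaling_def)
  have \<mu>': "\<mu> \<in> nonneg_measures" "measure \<mu> UNIV = 1" using \<mu> by (simp_all add: prob_measures_iff)
  let ?\<alpha> = "density \<mu> (\<lambda>x. ennreal (1 / g x))"
  note w = continuous_inverse_weight[OF gc]
  have \<alpha>: "?\<alpha> \<in> nonneg_measures" by (rule density_mem[OF cpt \<mu>'(1) w])
  show K: "K ?\<alpha> = g"
    using g by (intro ext) (simp only: mean_embedding_density[OF \<mu>'(1) gc] self_scaling_def)
  have int: "(\<integral>x. g x * f x \<partial>?\<alpha>) = (\<integral>x. f x \<partial>\<mu>)" if "continuous_on UNIV f" for f :: "'a \<Rightarrow> real"
  proof -
    have nz: "g x \<noteq> 0" for x using gc(2)[of x] by simp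
    have "continuous_on UNIV (\<lambda>x. g x * f x)" by (intro continuous_intros gc that)
    from integral_density_continuous[OF cpt \<mu>'(1) w this] show ?thesis by (simp add: nz)
  qed
  have "(\<integral>x. K ?\<alpha> x \<partial>?\<alpha>) = (\<integral>x. 1 \<partial>\<mu>)" unfolding K using int[OF continuous_on_const, of 1] by simp
  then show A: "?\<alpha> \<in> image_A k ip" using \<alpha> \<mu>'(2) integral_one[OF \<mu>'(1)] by (simp add: image_A_iff)
  have M: "kernel_marginal k ?\<alpha> \<in> nonneg_measures" using kernel_marginal_mem[OF A] prob_subset_nonneg by blast
  show "kernel_marginal k ?\<alpha> = \<mu>"
    by (rule measure_eqI_continuous[OF cpt M \<mu>'(1)]) (simp only: integral_kernel_marginal[OF \<alpha>] K int)
qed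

lemma image_A_pos: "\<alpha> \<in> image_A k ip \<Longrightarrow> 0 < K \<alpha> x"
proof -
  assume \<alpha>: "\<alpha> \<in> image_A k ip"
  obtain m where m: "m > 0" "\<And>x y. m \<le> k x y" using kernel_lower_bound by blast
  have "m * 1 \<le> m * measure \<alpha> UNIV" using image_A_mass(1)[OF \<alpha> m] m(1) by (intro mult_left_mono) auto
  moreover have "m * measure \<alpha> UNIV \<le> K \<alpha> x" using \<alpha> m(2) by (intro mean_embedding_bounds(2)) (auto simp: image_A_iff)
  ultimately show ?thesis using m(1) by linarith
qed

text \<open>The converse correspondence: dividing the marginal (K \<alpha>) \<alpha> by K \<alpha>
  gives back \<alpha>, so applying K to the quotient returns K \<alpha>.\<close>

lemma self_scaling_kernel_marginal:
  assumes \<alpha>: "\<alpha> \<in> image_A k ip"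
  shows "self_scaling k (kernel_marginal k \<alpha>) (K \<alpha>)"
    and "density (kernel_marginal k \<alpha>) (\<lambda>x. ennreal (1 / K \<alpha> x)) = \<alpha>"
proof -
  have n: "\<alpha> \<in> nonneg_measures" using \<alpha> by (simp add: image_A_iff)
  have M: "kernel_marginal k \<alpha> \<in> nonneg_measures" using kernel_marginal_mem[OF \<alpha>] prob_subset_nonneg by blast
  note gc = continuous_mean_embedding[OF n] image_A_pos[OF \<alpha>]
  note w = continuous_inverse_weight[OF gc]
  have nz: "K \<alpha> x \<noteq> 0" for x using gc(2)[of x] by simp
  have int: "(\<integral>x. f x / K \<alpha> x \<partial>kernel_marginal k \<alpha>) = (\<integral>x. f x \<partial>\<alpha>)" if "continuous_on UNIV f" for f :: "'a \<Rightarrow> real"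
  proof -
    have "continuous_on UNIV (\<lambda>x. 1 / K \<alpha> x * f x)" by (intro continuous_intros w that)
    from integral_kernel_marginal[OF n this] show ?thesis by (simp add: nz)
  qed
  show "self_scaling k (kernel_marginal k \<alpha>) (K \<alpha>)"
    unfolding self_scaling_def using gc int[OF continuous_kernel(2)] by (simp add: mean_embedding_def)
  show "density (kernel_marginal k \<alpha>) (\<lambda>x. ennreal (1 / K \<alpha> x)) = \<alpha>"
  proof (rule measure_eqI_continuous[OF cpt density_mem[OF cpt M w] n])
    fix f :: "'a \<Rightarrow> real" assume f: "continuous_on UNIV f"
    show "(\<integral>x. f x \<partial>density (kernel_marginal k \<alpha>) (\<lambda>x. ennreal (1 / K \<alpha> x))) = (\<integral>x. f x \<partial>\<alpha>)"
      using integral_density_continuous[OF cpt M w f] int[OF f] by simp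
  qed
qed

text \<open>
  Two scalings are unit vectors whose inner product is both the integral of \<open>g / h\<close> and that of
  \<open>h / g\<close>, hence at least 1 by AM-GM.
\<close>

lemma self_scaling_unique:
  assumes \<mu>: "\<mu> \<in> prob_measures" and g: "self_scaling k \<mu> g" and h: "self_scaling k \<mu> h"
  shows "g = h"
proof -
  have \<mu>': "\<mu> \<in> nonneg_measures" "measure \<mu> UNIV = 1" using \<mu> by (simp_all add: prob_measures_iff)
  have c: "continuous_on UNIV g" "continuous_on UNIV h" and p: "\<And>x. 0 < g x" "\<And>x. 0 < h x"
    using g h by (simp_all add: self_scaling_def)
  note D = self_scaling_density[OF \<mu> g] self_scaling_density[OF \<mu> h]
  have mem: "g \<in> H" "h \<in> H" using D(1,2,4,5) mean_embedding_mem image_A_iff by metis+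
  have ip1: "ip f f = 1" if f: "self_scaling k \<mu> f" for f
    using self_scaling_density(1,2)[OF \<mu> f] ip_mean_embedding_left mean_embedding_mem by (metis image_A_iff)
  have ip2: "ip f f' = (\<integral>x. f x / f' x \<partial>\<mu>)" if f: "self_scaling k \<mu> f'" "f \<in> H" for f f'
  proof -
    have fc: "continuous_on UNIV f'" "\<And>x. 0 < f' x" using f(1) by (simp_all add: self_scaling_def)
    let ?\<alpha> = "density \<mu> (\<lambda>x. ennreal (1 / f' x))"
    have "?\<alpha> \<in> nonneg_measures" using self_scaling_density(2)[OF \<mu> f(1)] by (simp add: image_A_iff)
    from ip_mean_embedding[OF this f(2)]
    have "ip f f' = (\<integral>x. f x \<partial>?\<alpha>)" by (simp only: self_scaling_density(1)[OF \<mu> f(1)])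
    also have "\<dots> = (\<integral>x. f x / f' x \<partial>\<mu>)"
      using integral_density_continuous[OF cpt \<mu>'(1) continuous_inverse_weight[OF fc] continuous_mem[OF f(2)]] by simp
    finally show ?thesis .
  qed
  have nz: "g x \<noteq> 0" "h x \<noteq> 0" for x using p[of x] by simp_all
  have "2 = (\<integral>x. (2::real) \<partial>\<mu>)" using integral_const_UNIV[OF \<mu>'(1), of 2] \<mu>'(2) by simp
  also have "\<dots> \<le> (\<integral>x. g x / h x + h x / g x \<partial>\<mu>)"
  proof (intro integral_mono continuous_integrable[OF cpt \<mu>'(1)] continuous_intros c)
    fix x
    have "0 \<le> (g x - h x)\<^sup>2 / (g x * h x)" using p[of x] by simp
    also have "\<dots> = g x / h x + h x / g x - 2" using nz[of x] by (simp add: field_simps power2_eq_square)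
    finally show "2 \<le> g x / h x + h x / g x" by simp
  qed (use nz in auto)
  also have "\<dots> = (\<integral>x. g x / h x \<partial>\<mu>) + (\<integral>x. h x / g x \<partial>\<mu>)"
    by (intro Bochner_Integration.integral_add continuous_integrable[OF cpt \<mu>'(1)] continuous_intros c) (use nz in auto)
  also have "\<dots> = 2 * ip g h" using ip2[OF h mem(1)] ip2[OF g mem(2)] ip_sym[OF mem] by simp
  finally have "(ip_dist H ip g h)\<^sup>2 \<le> 0" unfolding ip_dist_power2[OF mem] ip1[OF g] ip1[OF h] by simp
  then have "ip_dist H ip g h = 0" by simp
  then show ?thesis using mem by simp
qed

section \<open>Existence of a scaling by maximising the logarithmic integral\<close>

lemma image_B_bounds:
  assumes \<beta>: "\<beta> \<in> image_B k ip" and m: "m > 0" "\<And>x y. m \<le> k x y"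
  shows "m \<le> \<beta> x" "\<beta> x \<le> 1 / m"
proof -
  obtain \<alpha> where \<alpha>: "\<alpha> \<in> image_A k ip" "\<beta> = K \<alpha>" using \<beta> unfolding image_B_eq by blast
  have n: "\<alpha> \<in> nonneg_measures" using \<alpha> by (simp add: image_A_iff)
  have "m * 1 \<le> m * measure \<alpha> UNIV" using image_A_mass(1)[OF \<alpha>(1) m] m(1) by (intro mult_left_mono) auto
  then show "m \<le> \<beta> x" using mean_embedding_bounds(2)[OF n m(2), of x] unfolding \<alpha>(2) by linarith
  show "\<beta> x \<le> 1 / m" using mean_embedding_bounds(1)[OF n, of x] image_A_mass(2)[OF \<alpha>(1) m] unfolding \<alpha>(2) by linarith
qed

lemma image_B_nonempty: "image_B k ip \<noteq> {}"
proof -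
  fix z :: 'a
  have d: "return borel z \<in> nonneg_measures"
    using prob_space_return[of z borel] by (simp add: nonneg_measures_def prob_space.finite_measure)
  \<comment> \<open>A point mass of weight w at z has energy w^2 k z z, so this weight puts it in
    \<A>.\<close>
  define w where "w = 1 / sqrt (k z z)"
  have w: "0 \<le> w" "w * w * k z z = 1" using k_pos[of z z] by (simp_all add: w_def real_sqrt_mult[symmetric])
  let ?\<alpha> = "density (return borel z) (\<lambda>x. ennreal w)"
  note int = integral_density_continuous[OF cpt d continuous_on_const w(1)]
  have n: "?\<alpha> \<in> nonneg_measures" by (rule density_mem[OF cpt d continuous_on_const w(1)])
  have "K ?\<alpha> z = (\<integral>x. w * k x z \<partial>return borel z)"
    unfolding mean_embedding_def by (rule int[OF continuous_kernel(2)])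
  also have "\<dots> = w * k z z"
    by (subst integral_return) (auto intro!: borel_measurable_continuous_onI continuous_intros continuous_kernel)
  finally have Kz: "K ?\<alpha> z = w * k z z" .
  have "(\<integral>x. K ?\<alpha> x \<partial>?\<alpha>) = (\<integral>x. w * K ?\<alpha> x \<partial>return borel z)" by (rule int[OF continuous_mean_embedding[OF n]])
  also have "\<dots> = w * K ?\<alpha> z"
    by (subst integral_return) (auto intro!: borel_measurable_continuous_onI continuous_intros continuous_mean_embedding[OF n])
  finally have "(\<integral>x. K ?\<alpha> x \<partial>?\<alpha>) = 1" using w(2) by (simp add: Kz)
  then show ?thesis using n unfolding image_B_eq by (auto simp: image_A_iff)
qed

text \<open>The functional is continuous on the norm compact set \<B>: norm convergence is pointwise
  convergence in particular, and values in [m, 1 / m] bound the logarithms by - ln m, so dominated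
  convergence applies.\<close>

lemma log_integral_maximiser:
  assumes \<mu>: "\<mu> \<in> prob_measures"
  obtains \<beta> where "\<beta> \<in> image_B k ip" "\<And>\<gamma>. \<gamma> \<in> image_B k ip \<Longrightarrow> (\<integral>x. ln (\<gamma> x) \<partial>\<mu>) \<le> (\<integral>x. ln (\<beta> x) \<partial>\<mu>)"
proof -
  have \<mu>': "\<mu> \<in> nonneg_measures" using \<mu> prob_subset_nonneg by blast
  interpret finite_measure \<mu> using \<mu>' by (simp add: nonneg_measures_def)
  obtain m where m: "m > 0" "\<And>x y. m \<le> k x y" using kernel_lower_bound by blast
  let ?F = "\<lambda>\<beta>. \<integral>x. ln (\<beta> x) \<partial>\<mu>"
  have "continuous_map (subtopology M.mtopology (image_B k ip)) euclidean ?F"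
  proof (rule M.continuous_map_sequentiallyI[OF image_B_subset])
    fix s l assume s: "\<And>n. s n \<in> image_B k ip" and l: "l \<in> image_B k ip" and lim: "limitin M.mtopology s l sequentially"
    have sH: "s n \<in> H" for n using s image_B_subset by blast
    have cont: "continuous_on UNIV (\<lambda>x. ln (\<gamma> x))" if \<gamma>: "\<gamma> \<in> image_B k ip" for \<gamma>
    proof -
      have "\<gamma> \<in> H" using \<gamma> image_B_subset by blast
      moreover have "\<gamma> x \<noteq> 0" for x using image_B_bounds(1)[OF \<gamma> m, of x] m(1) by simp
      ultimately show ?thesis by (intro continuous_on_ln continuous_mem) auto
    qed
    show "(\<lambda>n. ?F (s n)) \<longlonglongrightarrow> ?F l"
    proof (rule integral_dominated_convergence[where w = "\<lambda>_. - ln m"])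
      show "(\<lambda>x. ln (l x)) \<in> borel_measurable \<mu>" "\<And>n. (\<lambda>x. ln (s n x)) \<in> borel_measurable \<mu>"
        by (intro measurable_continuous_nonneg_measures[OF \<mu>'] cont s l)+
      have "(\<lambda>n. ln (s n x)) \<longlonglongrightarrow> ln (l x)" for x
      proof (rule tendsto_ln)
        have "l \<in> H" using l image_B_subset by blast
        then show "(\<lambda>n. s n x) \<longlonglongrightarrow> l x" using tendsto_ip[OF lim sH k_mem] by (simp add: reproducing sH)
        show "l x \<noteq> 0" using image_B_bounds(1)[OF l m, of x] m(1) by simp
      qed
      then show "AE x in \<mu>. (\<lambda>n. ln (s n x)) \<longlonglongrightarrow> ln (l x)" by simp
      have "norm (ln (s n x)) \<le> - ln m" for n x
      proof -
        have b: "m \<le> s n x" "s n x \<le> 1 / m" using image_B_bounds[OF s m] by simp_all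
        then have "ln m \<le> ln (s n x)" "ln (s n x) \<le> ln (1 / m)" using m(1) by simp_all
        then show ?thesis using m(1) by (simp add: ln_div)
      qed
      then show "\<And>n. AE x in \<mu>. norm (ln (s n x)) \<le> - ln m" by simp
    qed simp
  qed
  moreover have "compactin (subtopology M.mtopology (image_B k ip)) (image_B k ip)"
    by (simp add: compactin_subtopology compactin_norm_image_B)
  ultimately have "compactin euclidean (?F ` image_B k ip)" by (intro image_compactin)
  then have "compact (?F ` image_B k ip)" by simp
  from compact_attains_sup[OF this] image_B_nonempty
  obtain v where v: "v \<in> ?F ` image_B k ip" "\<And>u. u \<in> ?F ` image_B k ip \<Longrightarrow> u \<le> v" by blast
  from v(1) obtain \<beta> where "\<beta> \<in> image_B k ip" "v = ?F \<beta>" by (rule imageE)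
  then show thesis using that v(2) by blast
qed

end

context positive_kernel_rkhs begin

text \<open>The competitor is \<beta> + t k z rescaled to norm 1, which stays in \<B> because it is
  the embedding of \<alpha> plus a point mass at z. Maximality bounds \<integral> ln (1 + t k x z /
  \<beta> x) d\<mu> by the logarithm of the norm; expanding both to first order in t, dividing by t
  and letting t tend to 0 gives the claim.\<close>

lemma maximiser_variation:
  assumes \<mu>: "\<mu> \<in> prob_measures" and \<beta>: "\<beta> \<in> image_B k ip"
    and max: "\<And>\<gamma>. \<gamma> \<in> image_B k ip \<Longrightarrow> (\<integral>x. ln (\<gamma> x) \<partial>\<mu>) \<le> (\<integral>x. ln (\<beta> x) \<partial>\<mu>)"
  shows "(\<integral>x. k x z / \<beta> x \<partial>\<mu>) \<le> \<beta> z"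
proof -
  have \<mu>': "\<mu> \<in> nonneg_measures" "measure \<mu> UNIV = 1" using \<mu> by (simp_all add: prob_measures_iff)
  have one: "measure \<mu> (space \<mu>) = 1" using measure_space_UNIV(3)[OF \<mu>'(1)] \<mu>'(2) by simp
  obtain m where m: "m > 0" "\<And>x y. m \<le> k x y" using kernel_lower_bound by blast
  obtain \<alpha> where \<alpha>: "\<alpha> \<in> image_A k ip" "\<beta> = K \<alpha>" using \<beta> unfolding image_B_eq by blast
  have n: "\<alpha> \<in> nonneg_measures" "(\<integral>x. \<beta> x \<partial>\<alpha>) = 1" using \<alpha> by (simp_all add: image_A_iff)
  have mass: "measure \<alpha> UNIV > 0" using image_A_mass(1)[OF \<alpha>(1) m] by simp
  have \<beta>c: "continuous_on UNIV \<beta>" using continuous_mean_embedding[OF n(1)] \<alpha>(2) by simp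
  have \<beta>m: "m \<le> \<beta> x" for x by (rule image_B_bounds(1)[OF \<beta> m])
  have \<beta>p: "0 < \<beta> x" for x using \<beta>m[of x] m(1) by linarith
  have nz: "\<beta> x \<noteq> 0" for x using \<beta>p[of x] by simp
  note int\<mu> = continuous_integrable[OF cpt \<mu>'(1)] and int\<alpha> = continuous_integrable[OF cpt n(1)]
  let ?D = "\<integral>x. k x z / \<beta> x \<partial>\<mu>"
  \<comment> \<open>For t \<le> m the quantity u = t k x z / \<beta> x is at most 1, the range in
    which u - u^2 \<le> ln (1 + u). That bound contributes the error 1 / m^2; the second-order term
    of the norm contributes 1 / 2.\<close>
  have key: "?D \<le> \<beta> z + t * (1 / 2 + 1 / m\<^sup>2)" if t: "0 < t" "t \<le> m" for t
  proof -
    \<comment> \<open>The squared norm of \<beta> + t k z, by the reproducing property and \<beta>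
      having norm 1.\<close>
    define Q where "Q = 1 + 2 * t * \<beta> z + t\<^sup>2 * k z z"
    have Q: "Q \<ge> 1" unfolding Q_def using t \<beta>p[of z] k_pos[of z z] by simp
    define c where "c = 1 / sqrt Q"
    have c: "c > 0" "c\<^sup>2 * Q = 1" using Q by (simp_all add: c_def power_divide)
    obtain \<gamma> where \<gamma>: "\<gamma> \<in> nonneg_measures"
      "\<And>f :: 'a \<Rightarrow> real. continuous_on UNIV f \<Longrightarrow> (\<integral>x. f x \<partial>\<gamma>) = c * ((\<integral>x. f x \<partial>\<alpha>) + t * f z)"
      by (rule add_point_mass[OF cpt n(1) mass less_imp_le[OF t(1)] less_imp_le[OF c(1)], of z]) (rule that)
    have K\<gamma>: "K \<gamma> y = c * (\<beta> y + t * k z y)" for y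
      unfolding \<alpha>(2) mean_embedding_def using \<gamma>(2)[OF continuous_kernel(2)] by simp
    have "(\<integral>x. k z x \<partial>\<alpha>) = \<beta> z" unfolding \<alpha>(2) mean_embedding_def by (simp only: k_sym[of z])
    then have "(\<integral>x. K \<gamma> x \<partial>\<alpha>) = c * (1 + t * \<beta> z)"
      unfolding K\<gamma> using int\<alpha>[OF \<beta>c] int\<alpha>[OF continuous_kernel(1), of z] n(2) by simp
    then have "(\<integral>x. K \<gamma> x \<partial>\<gamma>) = c * (c * (1 + t * \<beta> z) + t * (c * (\<beta> z + t * k z z)))"
      using \<gamma>(2)[OF continuous_mean_embedding[OF \<gamma>(1)]] by (simp only: K\<gamma>[of z])
    also have "\<dots> = c\<^sup>2 * Q" by (simp add: Q_def power2_eq_square algebra_simps)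
    finally have "(\<integral>x. K \<gamma> x \<partial>\<gamma>) = c\<^sup>2 * Q" .
    then have "K \<gamma> \<in> image_B k ip" using \<gamma>(1) c(2) unfolding image_B_eq by (auto simp: image_A_iff)
    from max[OF this] have "(\<integral>x. ln (K \<gamma> x) \<partial>\<mu>) \<le> (\<integral>x. ln (\<beta> x) \<partial>\<mu>)" .
    moreover have "ln (K \<gamma> x) = ln c + (ln (\<beta> x) + ln (1 + t * (k x z / \<beta> x)))" for x
    proof -
      have "\<beta> x + t * k z x = \<beta> x * (1 + t * (k x z / \<beta> x))" using nz[of x] k_sym[of x z] by (simp add: algebra_simps)
      moreover have "1 + t * (k x z / \<beta> x) > 0" using t k_pos[of x z] \<beta>p[of x] by (intro add_pos_pos) auto
      ultimately show ?thesis unfolding K\<gamma> using c(1) \<beta>p[of x] by (simp add: ln_mult_pos)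
    qed
    moreover have u: "0 \<le> t * (k x z / \<beta> x)" "t * (k x z / \<beta> x) \<le> t / m" for x
    proof -
      show "0 \<le> t * (k x z / \<beta> x)" using t k_pos[of x z] \<beta>p[of x] by simp
      have "k x z / \<beta> x \<le> 1 / m" using k_le_1[of x z] k_pos[of x z] \<beta>m[of x] m(1) by (intro frac_le) auto
      then have "t * (k x z / \<beta> x) \<le> t * (1 / m)" using t by (intro mult_left_mono) auto
      then show "t * (k x z / \<beta> x) \<le> t / m" by simp
    qed
    moreover have lnc: "continuous_on UNIV (\<lambda>x. ln (\<beta> x))" by (intro continuous_on_ln \<beta>c) (simp add: nz)
    moreover have quot: "continuous_on UNIV (\<lambda>x. k x z / \<beta> x)" by (intro continuous_intros continuous_kernel \<beta>c) (simp add: nz)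
    moreover have lnq: "continuous_on UNIV (\<lambda>x. ln (1 + t * (k x z / \<beta> x)))"
    proof (intro continuous_on_ln continuous_on_add continuous_on_mult continuous_on_const quot ballI)
      fix x show "1 + t * (k x z / \<beta> x) \<noteq> 0" using u(1)[of x] by linarith
    qed
    ultimately have "ln c + (\<integral>x. ln (1 + t * (k x z / \<beta> x)) \<partial>\<mu>) \<le> 0"
      using int\<mu>[OF lnc] int\<mu>[OF lnq] int\<mu>[OF continuous_on_const] one by simp
    moreover have "t * ?D - (t / m)\<^sup>2 \<le> (\<integral>x. ln (1 + t * (k x z / \<beta> x)) \<partial>\<mu>)"
    proof -
      have "t * ?D - (t / m)\<^sup>2 = (\<integral>x. t * (k x z / \<beta> x) - (t / m)\<^sup>2 \<partial>\<mu>)"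
        using int\<mu>[OF quot] int\<mu>[OF continuous_on_const] one by (simp del: times_divide_eq_right)
      also have "\<dots> \<le> (\<integral>x. ln (1 + t * (k x z / \<beta> x)) \<partial>\<mu>)"
      proof (intro integral_mono int\<mu> lnq continuous_on_diff continuous_on_mult_left continuous_on_const quot)
        fix x
        have "t / m \<le> 1" using t m(1) by simp
        then have "t * (k x z / \<beta> x) - (t * (k x z / \<beta> x))\<^sup>2 \<le> ln (1 + t * (k x z / \<beta> x))"
          using u[of x] by (intro ln_one_plus_pos_lower_bound) linarith+
        moreover have "(t * (k x z / \<beta> x))\<^sup>2 \<le> (t / m)\<^sup>2" by (rule power_mono[OF u(2,1)])
        ultimately show "t * (k x z / \<beta> x) - (t / m)\<^sup>2 \<le> ln (1 + t * (k x z / \<beta> x))" by linarith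
      qed
      finally show ?thesis .
    qed
    moreover have "- ln c \<le> t * \<beta> z + t\<^sup>2 / 2"
    proof -
      have "ln Q \<le> Q - 1" using Q by (intro ln_le_minus_one) simp
      also have "\<dots> \<le> 2 * t * \<beta> z + t\<^sup>2" using k_le_1[of z z] mult_left_mono[of "k z z" 1 "t\<^sup>2"] by (simp add: Q_def)
      finally show ?thesis using Q by (simp add: c_def ln_div ln_sqrt)
    qed
    ultimately have "t * ?D \<le> t * \<beta> z + t\<^sup>2 / 2 + (t / m)\<^sup>2" by linarith
    also have "\<dots> = t * (\<beta> z + t * (1 / 2 + 1 / m\<^sup>2))" by (simp add: power2_eq_square algebra_simps)
    finally show ?thesis using t(1) by simp
  qed
  show ?thesis
  proof (rule tendsto_lowerbound)
    show "((\<lambda>t. \<beta> z + t * (1 / 2 + 1 / m\<^sup>2)) \<longlongrightarrow> \<beta> z) (at_right 0)" by (auto intro!: tendsto_eq_intros)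
    show "\<forall>\<^sub>F t in at_right 0. ?D \<le> \<beta> z + t * (1 / 2 + 1 / m\<^sup>2)"
      unfolding eventually_at_right_field using key m(1) by (intro exI[of _ m]) (auto intro: less_imp_le)
  qed simp
qed

lemma self_scaling_exists:
  assumes \<mu>: "\<mu> \<in> prob_measures"
  obtains g where "self_scaling k \<mu> g"
proof -
  obtain \<beta> where \<beta>: "\<beta> \<in> image_B k ip" and
    max: "\<And>\<gamma>. \<gamma> \<in> image_B k ip \<Longrightarrow> (\<integral>x. ln (\<gamma> x) \<partial>\<mu>) \<le> (\<integral>x. ln (\<beta> x) \<partial>\<mu>)"
    by (rule log_integral_maximiser[OF \<mu>]) (rule that)
  have \<mu>': "\<mu> \<in> nonneg_measures" "measure \<mu> UNIV = 1" using \<mu> by (simp_all add: prob_measures_iff)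
  obtain \<alpha> where \<alpha>: "\<alpha> \<in> image_A k ip" "\<beta> = K \<alpha>" using \<beta> unfolding image_B_eq by blast
  have n: "\<alpha> \<in> nonneg_measures" "(\<integral>x. \<beta> x \<partial>\<alpha>) = 1" using \<alpha> by (simp_all add: image_A_iff)
  have c: "continuous_on UNIV \<beta>" using continuous_mean_embedding[OF n(1)] \<alpha>(2) by simp
  have p: "0 < \<beta> x" for x using image_A_pos[OF \<alpha>(1)] \<alpha>(2) by simp
  note w = continuous_inverse_weight[OF c p]
  define \<alpha>' where "\<alpha>' = density \<mu> (\<lambda>x. ennreal (1 / \<beta> x))"
  have \<alpha>': "\<alpha>' \<in> nonneg_measures" unfolding \<alpha>'_def by (rule density_mem[OF cpt \<mu>'(1) w])
  have int: "(\<integral>x. f x \<partial>\<alpha>') = (\<integral>x. 1 / \<beta> x * f x \<partial>\<mu>)" if "continuous_on UNIV f" for f :: "'a \<Rightarrow> real"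
    unfolding \<alpha>'_def by (rule integral_density_continuous[OF cpt \<mu>'(1) w that])
  have K': "K \<alpha>' y = (\<integral>x. k x y / \<beta> x \<partial>\<mu>)" for y
    unfolding \<alpha>'_def by (rule mean_embedding_density[OF \<mu>'(1) c p])
  have le: "K \<alpha>' x \<le> \<beta> x" for x unfolding K' by (rule maximiser_variation[OF \<mu> \<beta> max])
  have mem: "K \<alpha>' \<in> H" "\<beta> \<in> H" using mean_embedding_mem[OF \<alpha>'] mean_embedding_mem[OF n(1)] \<alpha>(2) by simp_all
  have one: "(\<integral>x. 1 \<partial>\<mu>) = (1::real)" using integral_one[OF \<mu>'(1)] \<mu>'(2) by simp
  have "ip (K \<alpha>') \<beta> = (\<integral>x. 1 / \<beta> x * \<beta> x \<partial>\<mu>)"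
    unfolding ip_mean_embedding_left[OF \<alpha>' mem(2)] by (rule int[OF c])
  also have "\<dots> = 1" using p one by (simp add: less_imp_neq[symmetric])
  finally have cross: "ip (K \<alpha>') \<beta> = 1" .
  have "ip (K \<alpha>') (K \<alpha>') = (\<integral>x. 1 / \<beta> x * K \<alpha>' x \<partial>\<mu>)"
    unfolding ip_mean_embedding_left[OF \<alpha>' mem(1)] by (rule int[OF continuous_mean_embedding[OF \<alpha>']])
  also have "\<dots> \<le> (\<integral>x. 1 \<partial>\<mu>)"
  proof (intro integral_mono continuous_integrable[OF cpt \<mu>'(1)] continuous_on_mult w continuous_mean_embedding[OF \<alpha>'] continuous_on_const)
    fix x show "1 / \<beta> x * K \<alpha>' x \<le> 1" using le[of x] p[of x] by simp
  qed
  finally have diag: "ip (K \<alpha>') (K \<alpha>') \<le> 1" by (simp only: one)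
  have "ip \<beta> \<beta> = 1" using ip_mean_embedding[OF n(1) mem(2)] n(2) \<alpha>(2) by simp
  then have "(ip_dist H ip (K \<alpha>') \<beta>)\<^sup>2 \<le> 0" unfolding ip_dist_power2[OF mem] cross using diag by simp
  then have "ip_dist H ip (K \<alpha>') \<beta> = 0" by simp
  then have "K \<alpha>' = \<beta>" using mem by simp
  then have "self_scaling k \<mu> \<beta>" unfolding self_scaling_def using c p K' by (metis (no_types))
  then show thesis by (rule that)
qed

section \<open>The homeomorphisms\<close>

lemma topspace_weak: "topspace (rkhs_weak_topology H ip) = H"
  by (auto simp: rkhs_weak_topology_def topspace_pullback_topology)

text \<open>Evaluation at x is the pairing with \<open>k x\<close>. These functionals separate the
  elements of H, which makes the weak topology Hausdorff.\<close>

lemma evaluation_mem_dual: "(\<lambda>f. f x) \<in> rkhs_dual H ip"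
proof -
  have "continuous_map (subtopology M.mtopology H) euclidean (\<lambda>f. f x)"
  proof (rule M.continuous_map_sequentiallyI[OF order_refl])
    fix s l assume s: "\<And>n. s n \<in> H" and l: "l \<in> H" and lim: "limitin M.mtopology s l sequentially"
    show "(\<lambda>n. s n x) \<longlonglongrightarrow> l x" using tendsto_ip[OF lim s k_mem] by (simp add: reproducing s l)
  qed
  then have "continuous_map M.mtopology euclidean (\<lambda>f. f x)"
    using subtopology_topspace[of M.mtopology] by simp
  then show ?thesis by (simp add: rkhs_dual_def rkhs_norm_topology_eq)
qed

lemma continuous_map_norm_weak: "continuous_map M.mtopology (rkhs_weak_topology H ip) id"
  unfolding rkhs_weak_topology_def
proof (rule continuous_map_pullback')
  show "continuous_map M.mtopology (product_topology (\<lambda>_. euclideanreal) (rkhs_dual H ip))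
      ((\<lambda>f. \<lambda>l\<in>rkhs_dual H ip. l f) \<circ> id)"
    unfolding continuous_map_componentwise by (auto simp: rkhs_dual_def rkhs_norm_topology_eq)
qed simp

lemma Hausdorff_rkhs_weak_topology: "Hausdorff_space (rkhs_weak_topology H ip)"
proof (rule Hausdorff_space_injective_preimage)
  let ?E = "\<lambda>f. \<lambda>l\<in>rkhs_dual H ip. l f :: real"
  show "Hausdorff_space (product_topology (\<lambda>_. euclideanreal) (rkhs_dual H ip))"
    by (simp add: Hausdorff_space_product_topology)
  have "continuous_map (rkhs_weak_topology H ip) (product_topology (\<lambda>_. euclideanreal) (rkhs_dual H ip)) (id \<circ> ?E)"
    unfolding rkhs_weak_topology_def by (intro continuous_map_pullback continuous_map_id)
  then show "continuous_map (rkhs_weak_topology H ip) (product_topology (\<lambda>_. euclideanreal) (rkhs_dual H ip)) ?E"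
    by simp
  show "inj_on ?E (topspace (rkhs_weak_topology H ip))"
  proof (rule inj_onI, rule ext)
    fix f g :: "'a \<Rightarrow> real" and x assume "?E f = ?E g"
    from fun_cong[OF this, of "\<lambda>f. f x"] show "f x = g x" by (simp add: evaluation_mem_dual)
  qed
qed

lemma subtopology_weak_eq_norm:
  "subtopology (rkhs_weak_topology H ip) (image_B k ip) = subtopology M.mtopology (image_B k ip)"
proof -
  have "homeomorphic_map (subtopology M.mtopology (image_B k ip)) (subtopology (rkhs_weak_topology H ip) (image_B k ip)) id"
  proof (rule continuous_imp_homeomorphic_map)
    show "continuous_map (subtopology M.mtopology (image_B k ip)) (subtopology (rkhs_weak_topology H ip) (image_B k ip)) id"
      using continuous_map_norm_weak by (simp add: continuous_map_in_subtopology continuous_map_from_subtopology)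
    show "compact_space (subtopology M.mtopology (image_B k ip))"
      by (rule compact_space_subtopology[OF compactin_norm_image_B])
    show "Hausdorff_space (subtopology (rkhs_weak_topology H ip) (image_B k ip))"
      by (rule Hausdorff_space_subtopology[OF Hausdorff_rkhs_weak_topology])
  qed (simp_all add: topspace_weak)
  then show ?thesis by simp
qed

section \<open>Continuous bijections out of \<B>\<close>

definition inverse_embedding :: "('a \<Rightarrow> real) \<Rightarrow> 'a measure" where
  "inverse_embedding = inv_into (image_A k ip) K"

lemma inj_on_image_A: "inj_on K (image_A k ip)"
  by (rule inj_on_subset[OF inj_on_mean_embedding]) (auto simp: image_A_iff)

lemma inverse_embedding_K: "\<alpha> \<in> image_A k ip \<Longrightarrow> inverse_embedding (K \<alpha>) = \<alpha>"
  unfolding inverse_embedding_def by (rule inv_into_f_f[OF inj_on_image_A])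

lemma K_inverse_embedding:
  "\<beta> \<in> image_B k ip \<Longrightarrow> inverse_embedding \<beta> \<in> image_A k ip \<and> K (inverse_embedding \<beta>) = \<beta>"
  unfolding image_B_eq by (auto simp: inverse_embedding_K)

abbreviation (input) "norm_B \<equiv> subtopology M.mtopology (image_B k ip)"
abbreviation (input) "weak_A \<equiv> subtopology weak_star (image_A k ip)"
abbreviation (input) "weak_P \<equiv> subtopology weak_star (prob_measures :: 'a measure set)"

lemma topspaces:
  "topspace norm_B = image_B k ip" "topspace weak_A = image_A k ip" "topspace weak_P = prob_measures"
  using image_B_subset prob_subset_nonneg by (auto simp: topspace_weak_star image_A_iff)

text \<open>Both \<open>K \<alpha>\<close> and \<open>K \<alpha>'\<close> are scalings of the common
  marginal, hence equal, and each measure is the marginal divided by its embedding.\<close>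

lemma kernel_marginal_inj:
  "\<alpha> \<in> image_A k ip \<Longrightarrow> \<alpha>' \<in> image_A k ip \<Longrightarrow> kernel_marginal k \<alpha> = kernel_marginal k \<alpha>' \<Longrightarrow> \<alpha> = \<alpha>'"
  using self_scaling_kernel_marginal[of \<alpha>] self_scaling_kernel_marginal[of \<alpha>']
    self_scaling_unique[OF kernel_marginal_mem] by metis

lemma kernel_marginal_surj: "kernel_marginal k ` image_A k ip = prob_measures"
proof -
  have "\<mu> \<in> kernel_marginal k ` image_A k ip" if \<mu>: "\<mu> \<in> prob_measures" for \<mu>
  proof -
    obtain g where g: "self_scaling k \<mu> g" by (rule self_scaling_exists[OF \<mu>])
    from imageI[OF self_scaling_density(2)[OF \<mu> g], of "kernel_marginal k"]
    show ?thesis by (simp only: self_scaling_density(3)[OF \<mu> g])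
  qed
  then show ?thesis using kernel_marginal_mem by auto
qed

lemma homeomorphic_map_inverse_embedding: "homeomorphic_map norm_B weak_A inverse_embedding"
proof (rule continuous_imp_homeomorphic_map)
  have "continuous_map norm_B weak_star inverse_embedding"
  proof (rule continuous_map_into_weak_star)
    show "inverse_embedding \<in> topspace norm_B \<rightarrow> nonneg_measures"
      using K_inverse_embedding by (auto simp: topspaces image_A_iff)
    fix f :: "'a \<Rightarrow> real" assume f: "continuous_on UNIV f"
    show "continuous_map norm_B euclideanreal (\<lambda>\<beta>. \<integral>x. f x \<partial>inverse_embedding \<beta>)"
    proof (rule M.continuous_map_sequentiallyI[OF image_B_subset])
      fix s l assume "\<And>n. s n \<in> image_B k ip" "l \<in> image_B k ip" "limitin M.mtopology s l sequentially"
      then show "(\<lambda>n. \<integral>x. f x \<partial>inverse_embedding (s n)) \<longlonglongrightarrow> (\<integral>x. f x \<partial>inverse_embedding l)"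
        by (intro norm_imp_weak_convergence f) (simp_all add: K_inverse_embedding)
    qed
  qed
  then show "continuous_map norm_B weak_A inverse_embedding"
    using K_inverse_embedding by (auto simp: continuous_map_in_subtopology topspaces)
  show "inverse_embedding ` topspace norm_B = topspace weak_A"
    unfolding topspaces unfolding image_B_eq image_image by (simp add: inverse_embedding_K)
  show "inj_on inverse_embedding (topspace norm_B)"
    unfolding topspaces by (rule inj_on_inverseI[where g = K]) (simp add: K_inverse_embedding)
qed (simp_all add: compact_space_subtopology compactin_norm_image_B Hausdorff_space_subtopology Hausdorff_weak_star cpt)

lemma homeomorphic_map_marginal: "homeomorphic_map norm_B weak_P (kernel_marginal k \<circ> inverse_embedding)"
proof (rule continuous_imp_homeomorphic_map)
  have img: "(kernel_marginal k \<circ> inverse_embedding) ` image_B k ip = prob_measures"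
    unfolding image_B_eq image_comp[symmetric] image_image using kernel_marginal_surj by (simp add: inverse_embedding_K)
  have "continuous_map norm_B weak_star (kernel_marginal k \<circ> inverse_embedding)"
  proof (rule continuous_map_into_weak_star)
    show "kernel_marginal k \<circ> inverse_embedding \<in> topspace norm_B \<rightarrow> nonneg_measures"
      using img prob_subset_nonneg unfolding topspaces by blast
    fix f :: "'a \<Rightarrow> real" assume f: "continuous_on UNIV f"
    show "continuous_map norm_B euclideanreal (\<lambda>\<beta>. \<integral>x. f x \<partial>(kernel_marginal k \<circ> inverse_embedding) \<beta>)"
    proof (rule M.continuous_map_sequentiallyI[OF image_B_subset], unfold comp_apply)
      fix s l assume "\<And>n. s n \<in> image_B k ip" "l \<in> image_B k ip" "limitin M.mtopology s l sequentially"
      then show "(\<lambda>n. \<integral>x. f x \<partial>kernel_marginal k (inverse_embedding (s n)))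
          \<longlonglongrightarrow> (\<integral>x. f x \<partial>kernel_marginal k (inverse_embedding l))"
        by (intro norm_imp_weak_convergence_marginal f) (simp_all add: K_inverse_embedding)
    qed
  qed
  then show "continuous_map norm_B weak_P (kernel_marginal k \<circ> inverse_embedding)"
    using img by (auto simp: continuous_map_in_subtopology topspaces)
  show "(kernel_marginal k \<circ> inverse_embedding) ` topspace norm_B = topspace weak_P"
    unfolding topspaces by (rule img)
  show "inj_on (kernel_marginal k \<circ> inverse_embedding) (topspace norm_B)"
    unfolding topspaces
    by (intro comp_inj_on inj_onI) (metis K_inverse_embedding, metis K_inverse_embedding imageE kernel_marginal_inj)
qed (simp_all add: compact_space_subtopology compactin_norm_image_B Hausdorff_space_subtopology Hausdorff_weak_star cpt)

text \<open>All that is asked of \<open>A\<close> is to be a right inverse of the marginal with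
  values in \<A>; injectivity of the marginal makes it the inverse. Its continuity is then read off
  from the inverses \<open>S\<close> and \<open>R\<close> of the two homeomorphisms out of \<B>,
  which are recognised as K after A and as K.\<close>

theorem homeomorphisms:
  assumes A: "\<And>\<mu>. \<mu> \<in> prob_measures \<Longrightarrow> A \<mu> \<in> image_A k ip \<and> kernel_marginal k (A \<mu>) = \<mu>"
  shows "homeomorphic_maps weak_P weak_A A (kernel_marginal k)"
    and "homeomorphic_map weak_P norm_B (K \<circ> A)"
    and "compactin weak_star (image_A k ip)"
proof -
  let ?T = "kernel_marginal k \<circ> inverse_embedding"
  obtain S where S: "homeomorphic_maps norm_B weak_P ?T S"
    using homeomorphic_map_marginal unfolding homeomorphic_map_maps by blast
  obtain R where R: "homeomorphic_maps norm_B weak_A inverse_embedding R"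
    using homeomorphic_map_inverse_embedding unfolding homeomorphic_map_maps by blast
  have AM: "A (kernel_marginal k \<alpha>) = \<alpha>" if "\<alpha> \<in> image_A k ip" for \<alpha>
    using A[OF kernel_marginal_mem[OF that]] that kernel_marginal_inj by blast
  have KA: "K (A \<mu>) \<in> image_B k ip" "?T (K (A \<mu>)) = \<mu>" if "\<mu> \<in> prob_measures" for \<mu>
    using A[OF that] by (simp_all add: image_B_eq inverse_embedding_K)
  have S_eq: "S \<mu> = K (A \<mu>)" if "\<mu> \<in> prob_measures" for \<mu>
    using S KA[OF that] unfolding homeomorphic_maps_def topspaces by metis
  have R_eq: "R \<alpha> = K \<alpha>" if "\<alpha> \<in> image_A k ip" for \<alpha>
    using R inverse_embedding_K[OF that] that unfolding homeomorphic_maps_def topspaces unfolding image_B_eq by (metis imageI)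
  have "homeomorphic_map weak_P norm_B S"
    using S homeomorphic_map_maps homeomorphic_maps_sym by blast
  then show "homeomorphic_map weak_P norm_B (K \<circ> A)"
    by (rule homeomorphic_map_eq) (simp only: topspaces S_eq comp_apply)
  show "homeomorphic_maps weak_P weak_A A (kernel_marginal k)"
    unfolding homeomorphic_maps_def topspaces
  proof (intro conjI ballI)
    have "continuous_map weak_P weak_A (inverse_embedding \<circ> S)"
      using S R unfolding homeomorphic_maps_def by (blast intro: continuous_map_compose)
    then show "continuous_map weak_P weak_A A"
      by (rule continuous_map_eq) (use A in \<open>simp add: topspaces S_eq inverse_embedding_K\<close>)
    have "continuous_map weak_A weak_P (?T \<circ> R)"
      using S R unfolding homeomorphic_maps_def by (blast intro: continuous_map_compose)
    then show "continuous_map weak_A weak_P (kernel_marginal k)"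
      by (rule continuous_map_eq) (simp add: topspaces R_eq inverse_embedding_K)
  qed (simp_all add: A AM)
  have "compactin norm_B (image_B k ip)" by (simp add: compactin_subtopology compactin_norm_image_B)
  then have "compactin weak_A (inverse_embedding ` image_B k ip)"
    using homeomorphic_imp_continuous_map[OF homeomorphic_map_inverse_embedding] by (rule image_compactin)
  then show "compactin weak_star (image_A k ip)"
    using homeomorphic_imp_surjective_map[OF homeomorphic_map_inverse_embedding]
    unfolding topspaces by (simp add: compactin_subtopology)
qed

end

text \<open>Multiplying the scaling equation at y by exp (f y / \<epsilon>) gives the Schroedinger
  equation, so g = exp (- f / \<epsilon>) is a bijection between continuous solutions f and scalings
  g. Uniqueness of g thus justifies the definite description.\<close>

lemma self_potential_scaling:
  fixes c :: "'a::metric_space \<Rightarrow> 'a \<Rightarrow> real"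
  assumes \<epsilon>: "\<epsilon> > 0" and g: "self_scaling (gibbs_kernel \<epsilon> c) \<mu> g"
    and unique: "\<And>h. self_scaling (gibbs_kernel \<epsilon> c) \<mu> h \<Longrightarrow> h = g"
  shows "self_potential \<epsilon> c \<mu> = (\<lambda>x. - \<epsilon> * ln (g x))"
proof -
  have gc: "continuous_on UNIV g" "\<And>x. 0 < g x" using g by (simp_all add: self_scaling_def)
  have iff: "(\<integral>x. exp (1 / \<epsilon> * (f x + f y - c x y)) \<partial>\<mu>) = 1 \<longleftrightarrow>
      (\<integral>x. gibbs_kernel \<epsilon> c x y / exp (- f x / \<epsilon>) \<partial>\<mu>) = exp (- f y / \<epsilon>)" for f y
  proof -
    have "exp (1 / \<epsilon> * (f x + f y - c x y)) = exp (f y / \<epsilon>) * (gibbs_kernel \<epsilon> c x y / exp (- f x / \<epsilon>))" for x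
      by (simp add: gibbs_kernel_def exp_diff[symmetric] exp_add[symmetric] add_divide_distrib diff_divide_distrib)
    then have eq: "(\<integral>x. exp (1 / \<epsilon> * (f x + f y - c x y)) \<partial>\<mu>)
        = exp (f y / \<epsilon>) * (\<integral>x. gibbs_kernel \<epsilon> c x y / exp (- f x / \<epsilon>) \<partial>\<mu>)"
      \<comment> \<open>A constant factor leaves the Bochner integral even for a non-integrable
        integrand, so the equivalence holds for every f.\<close>
      by (simp only: integral_mult_right_zero)
    have inv: "exp (- f y / \<epsilon>) = 1 / exp (f y / \<epsilon>)" by (simp add: exp_minus inverse_eq_divide)
    have "e * I = 1 \<longleftrightarrow> I = 1 / e" if "e > 0" for e I :: real using that by (simp add: eq_divide_eq mult.commute)
    from this[OF exp_gt_zero] show ?thesis unfolding eq inv .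
  qed
  show ?thesis
    unfolding self_potential_def
  proof (rule the_equality)
    have e: "exp (- (- \<epsilon> * ln (g x)) / \<epsilon>) = g x" for x using \<epsilon> gc(2)[of x] by simp
    have "continuous_on UNIV (\<lambda>x. - \<epsilon> * ln (g x))"
      by (intro continuous_intros gc(1)) (use gc(2) in \<open>simp add: less_imp_neq[symmetric]\<close>)
    then show "continuous_on UNIV (\<lambda>x. - \<epsilon> * ln (g x)) \<and>
        (\<forall>y. (\<integral>x. exp (1 / \<epsilon> * (- \<epsilon> * ln (g x) + - \<epsilon> * ln (g y) - c x y)) \<partial>\<mu>) = 1)"
      using g iff[of "\<lambda>x. - \<epsilon> * ln (g x)", unfolded e] unfolding self_scaling_def by blast
    fix f assume f: "continuous_on UNIV f \<and> (\<forall>y. (\<integral>x. exp (1 / \<epsilon> * (f x + f y - c x y)) \<partial>\<mu>) = 1)"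
    then have "continuous_on UNIV (\<lambda>x. exp (- f x / \<epsilon>))" using \<epsilon> by (intro continuous_intros) auto
    then have "self_scaling (gibbs_kernel \<epsilon> c) \<mu> (\<lambda>x. exp (- f x / \<epsilon>))"
      using f iff[of f] unfolding self_scaling_def by simp
    from unique[OF this] have "g x = exp (- f x / \<epsilon>)" for x by (simp add: fun_eq_iff)
    then show "f = (\<lambda>x. - \<epsilon> * ln (g x))" using \<epsilon> by simp
  qed
qed

theorem theorem4p8:
  fixes \<epsilon> :: real
    and c :: "'a::metric_space \<Rightarrow> 'a \<Rightarrow> real"
    and H :: "('a \<Rightarrow> real) set"
    and ip :: "('a \<Rightarrow> real) \<Rightarrow> ('a \<Rightarrow> real) \<Rightarrow> real"
  assumes "compact (UNIV :: 'a set)"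
    and "\<epsilon> > 0"
    and "continuous_on UNIV (\<lambda>(x, y). c x y)"
    and "\<And>x y. 0 \<le> c x y"
    and "\<And>x y. c x y = c y x"
    and "positive_definite_kernel (gibbs_kernel \<epsilon> c)"
    and "is_rkhs (gibbs_kernel \<epsilon> c) H ip"
    and "dense_in_continuous H"
  shows
    "(\<forall>\<mu>\<in>prob_measures. map_B \<epsilon> c \<mu> = (\<lambda>y. exp (- self_potential \<epsilon> c \<mu> y / \<epsilon>))) \<and>
     homeomorphic_maps (subtopology weak_star prob_measures) (subtopology weak_star (image_A (gibbs_kernel \<epsilon> c) ip))
       (map_A \<epsilon> c) (kernel_marginal (gibbs_kernel \<epsilon> c)) \<and>
     compactin weak_star (image_A (gibbs_kernel \<epsilon> c) ip) \<and>
     homeomorphic_map (subtopology weak_star prob_measures)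
       (subtopology (rkhs_weak_topology H ip) (image_B (gibbs_kernel \<epsilon> c) ip)) (map_B \<epsilon> c) \<and>
     subtopology (rkhs_weak_topology H ip) (image_B (gibbs_kernel \<epsilon> c) ip) =
       subtopology (rkhs_norm_topology H ip) (image_B (gibbs_kernel \<epsilon> c) ip) \<and>
     (\<forall>\<beta> l. range \<beta> \<subseteq> image_B (gibbs_kernel \<epsilon> c) ip \<and> l \<in> image_B (gibbs_kernel \<epsilon> c) ip \<longrightarrow>
        (limitin (rkhs_weak_topology H ip) \<beta> l sequentially \<longleftrightarrow>
         limitin (rkhs_norm_topology H ip) \<beta> l sequentially)) \<and>
     compactin (rkhs_weak_topology H ip) (image_B (gibbs_kernel \<epsilon> c) ip) \<and>
     compactin (rkhs_norm_topology H ip) (image_B (gibbs_kernel \<epsilon> c) ip)"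
proof -
  let ?k = "gibbs_kernel \<epsilon> c"
  interpret positive_kernel_rkhs ?k H ip
  proof
    have "(\<lambda>(x, y). ?k x y) = (\<lambda>z. exp (- (\<lambda>(x, y). c x y) z / \<epsilon>))"
      by (auto simp: gibbs_kernel_def)
    then show "continuous_on UNIV (\<lambda>(x, y). ?k x y)"
      using assms(2) by (simp only:) (intro continuous_intros assms(3), simp)
    show "?k x y \<le> 1" for x y using assms(2,4) by (simp add: gibbs_kernel_def)
  qed (use assms in \<open>simp_all add: gibbs_kernel_def\<close>)
  have potential: "map_A \<epsilon> c \<mu> \<in> image_A ?k ip \<and> kernel_marginal ?k (map_A \<epsilon> c \<mu>) = \<mu> \<and>
      map_B \<epsilon> c \<mu> = (\<lambda>y. exp (- self_potential \<epsilon> c \<mu> y / \<epsilon>))" if \<mu>: "\<mu> \<in> prob_measures" for \<mu>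
  proof -
    obtain g where g: "self_scaling ?k \<mu> g" by (rule self_scaling_exists[OF \<mu>])
    have p: "self_potential \<epsilon> c \<mu> = (\<lambda>x. - \<epsilon> * ln (g x))"
      by (rule self_potential_scaling[OF assms(2) g self_scaling_unique[OF \<mu> _ g]])
    have pos: "0 < g x" for x using g by (simp add: self_scaling_def)
    have A: "map_A \<epsilon> c \<mu> = density \<mu> (\<lambda>x. ennreal (1 / g x))"
      using assms(2) pos by (simp add: map_A_def p exp_minus inverse_eq_divide)
    have "(\<lambda>y. exp (- self_potential \<epsilon> c \<mu> y / \<epsilon>)) = g" using assms(2) pos by (simp add: p)
    then show ?thesis using self_scaling_density[OF \<mu> g] by (simp add: map_B_def A)
  qed
  have eq: "subtopology (rkhs_weak_topology H ip) (image_B ?k ip) = subtopology (rkhs_norm_topology H ip) (image_B ?k ip)"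
    unfolding rkhs_norm_topology_eq by (rule subtopology_weak_eq_norm)
  have lim: "limitin (rkhs_weak_topology H ip) \<beta> l sequentially \<longleftrightarrow> limitin (rkhs_norm_topology H ip) \<beta> l sequentially"
    if "range \<beta> \<subseteq> image_B ?k ip \<and> l \<in> image_B ?k ip" for \<beta> l
  proof -
    have "l \<in> image_B ?k ip" "\<beta> n \<in> image_B ?k ip" for n using that by auto
    then have "l \<in> image_B ?k ip" "\<forall>\<^sub>F n in sequentially. \<beta> n \<in> image_B ?k ip" by simp_all
    then show ?thesis
      using limitin_subtopology[of "rkhs_weak_topology H ip" "image_B ?k ip" \<beta> l sequentially]
        limitin_subtopology[of "rkhs_norm_topology H ip" "image_B ?k ip" \<beta> l sequentially]
      unfolding eq by blast
  qed
  have norm: "compactin (rkhs_norm_topology H ip) (image_B ?k ip)"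
    unfolding rkhs_norm_topology_eq by (rule compactin_norm_image_B)
  have "compactin (subtopology (rkhs_weak_topology H ip) (image_B ?k ip)) (image_B ?k ip)"
    unfolding eq by (simp add: compactin_subtopology norm)
  then have weak: "compactin (rkhs_weak_topology H ip) (image_B ?k ip)" by (simp add: compactin_subtopology)
  have A: "map_A \<epsilon> c \<mu> \<in> image_A ?k ip \<and> kernel_marginal ?k (map_A \<epsilon> c \<mu>) = \<mu>" if "\<mu> \<in> prob_measures" for \<mu>
    using potential[OF that] by simp
  have "map_B \<epsilon> c = K \<circ> map_A \<epsilon> c" by (simp add: fun_eq_iff map_B_def)
  then have B: "homeomorphic_map (subtopology weak_star prob_measures)
      (subtopology (rkhs_weak_topology H ip) (image_B ?k ip)) (map_B \<epsilon> c)"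
    using homeomorphisms(2)[OF A] by (simp only: eq rkhs_norm_topology_eq)
  show ?thesis
    using potential homeomorphisms(1,3)[OF A] B eq lim weak norm by blast
qed

end
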